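(* Let $\mathcal{F}=\{F_\theta:\theta\in\Theta\}$ be a natural exponential family with basis $\beta$, Laplace transform $L$ and cumulant function $\kappa=\log L$. (1) $\mathcal{F}$ is infinitely divisible if and only if there is a triple $(\epsilon,\sigma^2,\nu)$, with $\epsilon\in\mathbb{R}$, $\sigma^2\ge 0$ and $\nu$ a Lévy measure, which is a Lévy triple of $\kappa$, i.e. $$\kappa(\theta)=\epsilon\theta+\tfrac12\sigma^2\theta^2+\int_{\mathbb{R}\setminus\{0\}}\left(e^{\theta x}-1-\theta\tau(x)\right)\nu(dx),\qquad \theta\in\Theta,$$ for some centering function $\tau$, and such that $$\kappa''(\theta)=\int e^{\theta x}\rho(dx)\quad\text{for all }\theta\in\Theta,\qquad\text{where }\ \rho(dx)=\sigma^2\delta_0(dx)+x^2\nu(dx).$$ (2) Consequently, if $\mathcal{F}$ is infinitely divisible and $\alpha=\beta\ast\rho$, then for a function $\varphi$ the condition $$\int\varphi(x)e^{x\theta}\beta(dx)=L(\theta)\kappa''(\theta),\qquad\forall\theta\in\Theta,$$ is equivalent to $$\int\varphi(x)e^{\theta x}\beta(dx)=\int e^{\theta x}\alpha(dx),\qquad\forall\theta\in\Theta.$$ (3) Further, if $\mathcal{F}$ is infinitely divisible and $\alpha\ll\beta$, then a function $\varphi$ satisfying these conditions exists, namely the Radon–Nikodym derivative $\varphi=\frac{d\alpha}{d\beta}$.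
   Context: Natural exponential family (NEF): let $\beta$ be a positive Radon measure on $\mathbb{R}$ not concentrated on one point, let $L(\theta)=\int e^{x\theta}\beta(dx)$ be its Laplace transform, and let $\Theta$ be the maximal open set of $\theta\in\mathbb{R}$ with $L(\theta)<\infty$, assumed non-empty. The NEF with basis $\beta$ is $\mathcal{F}=\{F_\theta:\theta\in\Theta\}$, $F_\theta(dx)=\exp[\theta x-\log L(\theta)]\,\beta(dx)$. Standing assumption (without loss of generality): $0\in\Theta$ and $\beta(\mathbb{R})=1$, so that $\beta\in\mathcal{F}$. The cumulant function is $\kappa(\theta)=\log L(\theta)$, $\theta\in\Theta$; the mean of $F_\theta$ is $\kappa'(\theta)$ and its variance is $\kappa''(\theta)$. $\mathcal{F}$ is infinitely divisible if its members $F_\theta$ are infinitely divisible probability measures. A Lévy measure is a positive measure $\nu$ on $\mathbb{R}\setminus\{0\}$ with $\int\min(1,x^2)\,\nu(dx)<\infty$. A centering function is a function $\tau:\mathbb{R}\to\mathbb{R}$ such that $x^{-2}(\tau(x)-x)$ is bounded as $x\to0$ (and such that the integral in which it appears is well defined). $\delta_y$ is the Dirac mass at $y$, $\ast$ is convolution of measures, and $\alpha\ll\beta$ means that $\alpha$ is absolutely continuous with respect to $\beta$. If $\xi_\theta$ has distribution $F_\theta$, the condition $\int\varphi(x)e^{x\theta}\beta(dx)=L(\theta)\kappa''(\theta)$ for all $\theta\in\Theta$ is equivalent to $\mathbb{E}[\varphi(\xi_\theta)]=\mathbb{V}[\xi_\theta]$ for all $\theta\in\Theta$, where $\mathbb{E}$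 and $\mathbb{V}$ denote mean and variance and $\varphi$ does not depend on $\theta$; such a $\varphi$ is called a reduction function. *)

theory Defs
  imports "HOL-Probability.Probability"
begin

definition laplace :: "real measure \<Rightarrow> real \<Rightarrow> real" where
  "laplace \<beta> \<theta> = (\<integral>x. exp (\<theta> * x) \<partial>\<beta>)"

(* The union of all open sets on which the Laplace transform is finite. *)
definition nef_domain :: "real measure \<Rightarrow> real set" where
  "nef_domain \<beta> = interior {\<theta>. (\<integral>\<^sup>+x. ennreal (exp (\<theta> * x)) \<partial>\<beta>) < \<infinity>}"

definition cumulant :: "real measure \<Rightarrow> real \<Rightarrow> real" where
  "cumulant \<beta> \<theta> = ln (laplace \<beta> \<theta>)"

(* On the real line a Radon measure is a Borel measure that is finite on compact sets. *)
definition nef_basis :: "real measure \<Rightarrow> bool" where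
  "nef_basis \<beta> \<longleftrightarrow>
     sets \<beta> = sets borel \<and>
     (\<forall>K. compact K \<longrightarrow> emeasure \<beta> K < \<infinity>) \<and>
     \<not> (\<exists>c. emeasure \<beta> (UNIV - {c}) = 0) \<and>
     nef_domain \<beta> \<noteq> {}"

definition nef_member :: "real measure \<Rightarrow> real \<Rightarrow> real measure" where
  "nef_member \<beta> \<theta> = density \<beta> (\<lambda>x. ennreal (exp (\<theta> * x - cumulant \<beta> \<theta>)))"

definition nef :: "real measure \<Rightarrow> real measure set" where
  "nef \<beta> = nef_member \<beta> ` nef_domain \<beta>"

primrec conv_power :: "nat \<Rightarrow> real measure \<Rightarrow> real measure" where
  "conv_power 0 \<mu> = return borel 0"
| "conv_power (Suc n) \<mu> = (\<mu> \<star> conv_power n \<mu>)"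

definition infinitely_divisible :: "real measure \<Rightarrow> bool" where
  "infinitely_divisible \<mu> \<longleftrightarrow>
     (\<forall>n\<ge>1. \<exists>\<mu>n. prob_space \<mu>n \<and> sets \<mu>n = sets borel \<and> conv_power n \<mu>n = \<mu>)"

definition infinitely_divisible_family :: "real measure set \<Rightarrow> bool" where
  "infinitely_divisible_family F \<longleftrightarrow> (\<forall>\<mu>\<in>F. infinitely_divisible \<mu>)"

(* A measure on the punctured line is represented by a Borel measure on the line that does not
   charge the origin, so that integrals over the punctured line are integrals over the line. *)
definition levy_measure :: "real measure \<Rightarrow> bool" where
  "levy_measure \<nu> \<longleftrightarrow>
     sets \<nu> = sets borel \<and> emeasure \<nu> {0} = 0 \<and>
     (\<integral>\<^sup>+x. ennreal (min 1 (x\<^sup>2)) \<partial>\<nu>) < \<infinity>"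

definition centering_function :: "(real \<Rightarrow> real) \<Rightarrow> bool" where
  "centering_function \<tau> \<longleftrightarrow> Bfun (\<lambda>x. (\<tau> x - x) / x\<^sup>2) (at 0)"

(* The Bochner integral is 0 on non-integrable functions, so the well-definedness of the
   integral is part of the condition. *)
definition levy_triple :: "real measure \<Rightarrow> real \<Rightarrow> real \<Rightarrow> real measure \<Rightarrow> bool" where
  "levy_triple \<beta> \<epsilon> \<sigma>2 \<nu> \<longleftrightarrow>
     \<sigma>2 \<ge> 0 \<and> levy_measure \<nu> \<and>
     (\<exists>\<tau>. centering_function \<tau> \<and>
       (\<forall>\<theta>\<in>nef_domain \<beta>.
          integrable \<nu> (\<lambda>x. exp (\<theta> * x) - 1 - \<theta> * \<tau> x) \<and>
          cumulant \<beta> \<theta> =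
            \<epsilon> * \<theta> + \<sigma>2 * \<theta>\<^sup>2 / 2 + (\<integral>x. exp (\<theta> * x) - 1 - \<theta> * \<tau> x \<partial>\<nu>)))"

definition levy_rho :: "real \<Rightarrow> real measure \<Rightarrow> real measure" where
  "levy_rho \<sigma>2 \<nu> = measure_of UNIV (sets borel)
     (\<lambda>A. emeasure (scale_measure (ennreal \<sigma>2) (return borel 0)) A +
          emeasure (density \<nu> (\<lambda>x. ennreal (x\<^sup>2))) A)"

lemma sets_levy_rho [simp]: "sets (levy_rho \<sigma>2 \<nu>) = sets borel"
  using sets.sets_measure_of_eq[of "borel :: real measure"] by (simp add: levy_rho_def)

lemma emeasure_levy_rho:
  assumes "sets \<nu> = sets borel" and A: "A \<in> sets borel"
  shows "emeasure (levy_rho \<sigma>2 \<nu>) A =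
    ennreal \<sigma>2 * indicator A 0 + (\<integral>\<^sup>+x\<in>A. ennreal (x\<^sup>2) \<partial>\<nu>)"
proof -
  let ?M = "scale_measure (ennreal \<sigma>2) (return borel (0::real))"
  let ?N = "density \<nu> (\<lambda>x. ennreal (x\<^sup>2))"
  let ?f = "\<lambda>A. emeasure ?M A + emeasure ?N A"
  have sets: "sets ?M = sets borel" "sets ?N = sets borel"
    using assms by auto
  have "countably_additive (sets borel) ?f"
  proof (rule countably_additiveI)
    fix B :: "nat \<Rightarrow> real set"
    assume B: "range B \<subseteq> sets borel" "disjoint_family B"
    then have "(\<Sum>i. ?f (B i)) = (\<Sum>i. emeasure ?M (B i)) + (\<Sum>i. emeasure ?N (B i))"
      by (intro suminf_add[symmetric]) auto
    also have "\<dots> = ?f (\<Union>i. B i)"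
      using B sets by (subst (1 2) suminf_emeasure) auto
    finally show "(\<Sum>i. ?f (B i)) = ?f (\<Union>i. B i)" .
  qed
  moreover have "positive (sets borel) ?f"
    by (simp add: positive_def)
  moreover have "sigma_algebra (UNIV :: real set) (sets borel)"
    using sets.sigma_algebra_axioms[of "borel :: real measure"] by simp
  ultimately have "emeasure (levy_rho \<sigma>2 \<nu>) A = ?f A"
    unfolding levy_rho_def using A by (intro emeasure_measure_of_sigma) auto
  moreover have "(\<lambda>x. ennreal (x\<^sup>2)) \<in> borel_measurable \<nu>"
    using assms(1) by (subst measurable_cong_sets[OF assms(1) refl]) simp
  ultimately show ?thesis
    using assms by (simp add: emeasure_density)
qed

definition reduction_function :: "real measure \<Rightarrow> (real \<Rightarrow> real) \<Rightarrow> bool" where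
  "reduction_function \<beta> \<phi> \<longleftrightarrow>
     (\<forall>\<theta>\<in>nef_domain \<beta>. has_bochner_integral \<beta> (\<lambda>x. \<phi> x * exp (x * \<theta>))
        (laplace \<beta> \<theta> * deriv (deriv (cumulant \<beta>)) \<theta>))"

definition laplace_agrees :: "real measure \<Rightarrow> (real \<Rightarrow> real) \<Rightarrow> real measure \<Rightarrow> bool" where
  "laplace_agrees \<beta> \<phi> \<alpha> \<longleftrightarrow>
     (\<forall>\<theta>\<in>nef_domain \<beta>.
        integrable \<beta> (\<lambda>x. \<phi> x * exp (\<theta> * x)) \<and> integrable \<alpha> (\<lambda>x. exp (\<theta> * x)) \<and>
        (\<integral>x. \<phi> x * exp (\<theta> * x) \<partial>\<beta>) = (\<integral>x. exp (\<theta> * x) \<partial>\<alpha>))"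

definition levy_variance_repr :: "real measure \<Rightarrow> real \<Rightarrow> real measure \<Rightarrow> bool" where
  "levy_variance_repr \<beta> \<sigma>2 \<nu> \<longleftrightarrow>
     (\<forall>\<theta>\<in>nef_domain \<beta>. has_bochner_integral (levy_rho \<sigma>2 \<nu>) (\<lambda>x. exp (\<theta> * x))
        (deriv (deriv (cumulant \<beta>)) \<theta>))"

end

theory Submission
  imports Defs "HOL-Complex_Analysis.Complex_Analysis" "HOL-Real_Asymp.Real_Asymp"
begin

text \<open>A Laplace transform on an open interval around \<open>0\<close> determines a probability measure, and a
  pointwise limit of such transforms is again the Laplace transform of a probability measure. If \<open>\<mu>\<^sub>n\<close> is the \<open>n\<close>-th convolution root of \<open>\<beta>\<close>, its Laplace transform is
  \<open>exp (\<kappa> / n)\<close>, so the transforms of \<open>n * x\<^sup>2 * \<mu>\<^sub>n(dx)\<close> converge to \<open>\<kappa>''\<close>, and the limit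
  measure is \<open>\<rho>\<close>. Conversely, if \<open>\<kappa>''\<close> is the Laplace transform of \<open>\<rho>\<close>, integrating twice gives
  Kolmogorov's canonical form of \<open>\<kappa>\<close>, and \<open>exp (\<kappa> / n)\<close> is a limit of Laplace transforms of
  shifted compound Poisson laws, hence that of an \<open>n\<close>-th root. Tilting \<open>\<beta>\<close> by \<open>\<theta>\<close> tilts \<open>\<rho>\<close>,
  so the argument covers every member of the family.\<close>

section \<open>Laplace transforms on an open set\<close>

text \<open>Everything rests on \<open>0\<close> lying in the open domain, so that exponential
  moments exist on both sides of the origin. Hence \<rho> is finite, with mass \<kappa>''(0),
  although \<nu> may have infinite mass near \<open>0\<close>; this is why \<rho> rather than \<nu>
  carries the argument. It also permits the centering \<tau>(x) = x, which makes \<epsilon> =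
  \<kappa>'(0), while \<sigma>^2 is the atom of \<rho> at \<open>0\<close>. The obstacle in the
  limits is that weak convergence tests only bounded continuous functions, whereas exp(\<theta> x)
  is unbounded. Openness leaves room for a slightly larger exponent, and that gives the missing
  uniform integrability. The limit theorem concerns probability measures, so the second-moment
  measures are divided by their masses. This needs \<kappa>''(0) > 0, and there the non-degeneracy
  of \<beta> enters.\<close>

text \<open>A dominated second derivative bounds the Taylor remainder of the integrand by
  \<open>B x * (norm h)\<^sup>2\<close>, so the difference quotient of the integral is off by at
  most \<open>C * norm h\<close>. Working over a general field covers the real kernels and the
  complex transforms at once.\<close>

lemma has_field_derivative_integral_of_bounded_second:
  fixes F F' F'' :: "'a::{real_normed_field,banach,second_countable_topology} \<Rightarrow> 'b \<Rightarrow> 'a"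
  assumes r: "r > 0"
    and F: "\<And>z. z \<in> ball z0 r \<Longrightarrow> integrable M (F z)"
    and F': "integrable M (F' z0)" and B: "integrable M B"
    and D: "\<And>z x. z \<in> ball z0 r \<Longrightarrow> ((\<lambda>z. F z x) has_field_derivative F' z x) (at z)"
    and D': "\<And>z x. z \<in> ball z0 r \<Longrightarrow> ((\<lambda>z. F' z x) has_field_derivative F'' z x) (at z)"
    and F'': "\<And>z x. z \<in> ball z0 r \<Longrightarrow> norm (F'' z x) \<le> B x"
  shows "((\<lambda>z. \<integral>x. F z x \<partial>M) has_field_derivative (\<integral>x. F' z0 x \<partial>M)) (at z0)"
proof -
  define I where "I = (\<lambda>z. \<integral>x. F z x \<partial>M)"
  define C where "C = (\<integral>x. B x \<partial>M)"
  have bound: "norm ((I (z0 + h) - I z0) / h - (\<integral>x. F' z0 x \<partial>M)) \<le> C * norm h"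
    if h: "norm h < r" "h \<noteq> 0" for h
  proof -
    have z: "z0 + h \<in> ball z0 r" "z0 \<in> ball z0 r" using h r by (auto simp: dist_norm)
    have T: "norm (F (z0 + h) x - F z0 x - h * F' z0 x) \<le> B x * (norm h)\<^sup>2" for x
    proof -
      define f where "f = (\<lambda>i::nat. \<lambda>z. if i = 0 then F z x else if i = 1 then F' z x else F'' z x)"
      have "norm (f 0 (z0 + h) - (\<Sum>i\<le>1. f i z0 * (z0 + h - z0) ^ i / fact i))
          \<le> B x * norm (z0 + h - z0) ^ Suc 1 / fact 1"
      proof (rule field_Taylor)
        show "convex (ball z0 r)" by simp
        show "(f i has_field_derivative f (Suc i) y) (at y within ball z0 r)"
          if "y \<in> ball z0 r" "i \<le> 1" for i y
        proof (cases "i = 0")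
          case True
          then show ?thesis using D[OF that(1)] by (simp add: f_def has_field_derivative_at_within)
        next
          case False
          then have "i = 1" using that by auto
          then show ?thesis using D'[OF that(1)] by (simp add: f_def has_field_derivative_at_within)
        qed
      qed (use z F'' in \<open>auto simp: f_def\<close>)
      then show ?thesis by (simp add: f_def power2_eq_square algebra_simps)
    qed
    have int: "integrable M (\<lambda>x. F (z0 + h) x - F z0 x - h * F' z0 x)"
      using F[OF z(1)] F[OF z(2)] F' by auto
    have "norm (\<integral>x. F (z0 + h) x - F z0 x - h * F' z0 x \<partial>M)
        \<le> (\<integral>x. norm (F (z0 + h) x - F z0 x - h * F' z0 x) \<partial>M)"
      by (rule integral_norm_bound)
    also have "\<dots> \<le> (\<integral>x. B x * (norm h)\<^sup>2 \<partial>M)"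
    proof (rule integral_mono)
      show "integrable M (\<lambda>x. norm (F (z0 + h) x - F z0 x - h * F' z0 x))"
        using int by (rule integrable_norm)
      show "integrable M (\<lambda>x. B x * (norm h)\<^sup>2)" using B by (rule integrable_mult_left)
    qed (rule T)
    finally have *: "norm (\<integral>x. F (z0 + h) x - F z0 x - h * F' z0 x \<partial>M) \<le> C * (norm h)\<^sup>2"
      unfolding C_def by (simp only: Bochner_Integration.integral_mult_left_zero)
    have "(\<integral>x. F (z0 + h) x - F z0 x - h * F' z0 x \<partial>M) = I (z0 + h) - I z0 - h * (\<integral>x. F' z0 x \<partial>M)"
      unfolding I_def by (simp add: F[OF z(1)] F[OF z(2)] F')
    with * have *: "norm (I (z0 + h) - I z0 - h * (\<integral>x. F' z0 x \<partial>M)) \<le> C * (norm h)\<^sup>2"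
      by (simp only:)
    have "(I (z0 + h) - I z0) / h - (\<integral>x. F' z0 x \<partial>M) = (I (z0 + h) - I z0 - h * (\<integral>x. F' z0 x \<partial>M)) / h"
      using h by (simp add: field_simps)
    then have "norm ((I (z0 + h) - I z0) / h - (\<integral>x. F' z0 x \<partial>M))
        = norm (I (z0 + h) - I z0 - h * (\<integral>x. F' z0 x \<partial>M)) / norm h"
      by (simp only: norm_divide)
    also have "\<dots> \<le> C * (norm h)\<^sup>2 / norm h" by (intro divide_right_mono *) auto
    finally show ?thesis using h by (simp add: power2_eq_square)
  qed
  have "((\<lambda>h. (I (z0 + h) - I z0) / h - (\<integral>x. F' z0 x \<partial>M)) \<longlongrightarrow> 0) (at 0)"
  proof (rule Lim_null_comparison)
    show "\<forall>\<^sub>F h in at 0. norm ((I (z0 + h) - I z0) / h - (\<integral>x. F' z0 x \<partial>M)) \<le> C * norm h"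
      unfolding eventually_at using r bound by (intro exI[of _ r]) auto
    show "((\<lambda>h::'a. C * norm h) \<longlongrightarrow> 0) (at 0)"
      by (intro tendsto_eq_intros) auto
  qed
  then show ?thesis unfolding DERIV_def I_def[symmetric] by (rule LIM_zero_cancel)
qed

section \<open>Domination of moments by exponentials\<close>

lemma abs_power_le_exp:
  fixes x d :: real
  assumes "d > 0"
  shows "\<bar>x\<bar> ^ k \<le> fact k / d ^ k * exp (d * \<bar>x\<bar>)"
proof -
  have "(d * \<bar>x\<bar>) ^ k /\<^sub>R fact k \<le> (\<Sum>n. (d * \<bar>x\<bar>) ^ n /\<^sub>R fact n)"
    using sum_le_suminf[OF summable_exp_generic[of "d * \<bar>x\<bar>"], of "{k}"] assms by auto
  then have "(d * \<bar>x\<bar>) ^ k / fact k \<le> exp (d * \<bar>x\<bar>)"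
    by (simp add: exp_def divide_inverse mult.commute)
  then show ?thesis using assms by (simp add: field_simps power_mult_distrib)
qed

lemma exp_abs_le: "exp (d * \<bar>x\<bar>) \<le> exp (d * x) + exp (- d * x)" for x d :: real
  by (cases "x \<ge> 0") auto

text \<open>One \<open>d\<close> pays for moving the exponent from \<open>a\<close> to
  \<open>b\<close>, a second one for the power of \<open>x\<close>; hence the exponents
  \<open>a + 2 * d\<close> and \<open>a - 2 * d\<close>. The bound does not involve
  \<open>b\<close>, so it dominates on a whole neighbourhood of \<open>a\<close>.\<close>

lemma abs_power_exp_le:
  fixes x d a :: real
  assumes "d > 0" and "\<bar>b - a\<bar> \<le> d"
  shows "\<bar>x\<bar> ^ k * exp (b * x)
    \<le> fact k / d ^ k * (exp ((a + 2 * d) * x) + exp ((a - 2 * d) * x))"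
proof -
  have "(b - a) * x \<le> \<bar>b - a\<bar> * \<bar>x\<bar>" by (metis abs_ge_self abs_mult)
  also have "\<dots> \<le> d * \<bar>x\<bar>" using assms by (intro mult_right_mono) auto
  finally have "b * x \<le> a * x + d * \<bar>x\<bar>" by (simp add: algebra_simps)
  then have "\<bar>x\<bar> ^ k * exp (b * x) \<le> (fact k / d ^ k * exp (d * \<bar>x\<bar>)) * exp (a * x + d * \<bar>x\<bar>)"
    using assms by (intro mult_mono abs_power_le_exp) auto
  also have "\<dots> = fact k / d ^ k * (exp (a * x) * exp ((2 * d) * \<bar>x\<bar>))"
    by (simp add: exp_add[symmetric] algebra_simps)
  also have "\<dots> \<le> fact k / d ^ k * (exp (a * x) * (exp ((2 * d) * x) + exp (- (2 * d) * x)))"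
    using assms exp_abs_le[of "2 * d" x] by (intro mult_left_mono) auto
  also have "exp (a * x) * (exp ((2 * d) * x) + exp (- (2 * d) * x))
    = exp ((a + 2 * d) * x) + exp ((a - 2 * d) * x)"
    by (simp add: exp_add[symmetric] distrib_left) (simp add: algebra_simps)
  finally show ?thesis .
qed

text \<open>Integrability is built in, since a bare equation of Bochner integrals could hold through
  the default value \<open>0\<close>.\<close>

definition has_laplace :: "real measure \<Rightarrow> real set \<Rightarrow> (real \<Rightarrow> real) \<Rightarrow> bool" where
  "has_laplace M S f \<longleftrightarrow> (\<forall>\<theta>\<in>S. has_bochner_integral M (\<lambda>x. exp (\<theta> * x)) (f \<theta>))"

lemma has_laplaceD:
  assumes "has_laplace M S f" "\<theta> \<in> S"
  shows "integrable M (\<lambda>x. exp (\<theta> * x))" "(\<integral>x. exp (\<theta> * x) \<partial>M) = f \<theta>"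
  using assms by (auto simp: has_laplace_def has_bochner_integral_iff)

lemma has_laplaceI:
  assumes "\<And>\<theta>. \<theta> \<in> S \<Longrightarrow> integrable M (\<lambda>x. exp (\<theta> * x))"
    "\<And>\<theta>. \<theta> \<in> S \<Longrightarrow> (\<integral>x. exp (\<theta> * x) \<partial>M) = f \<theta>"
  shows "has_laplace M S f"
  using assms by (auto simp: has_laplace_def has_bochner_integral_iff)

lemma open_real_radius:
  fixes a :: real
  assumes "open S" "a \<in> S"
  obtains d where "d > 0" "\<And>b. \<bar>b - a\<bar> \<le> 2 * d \<Longrightarrow> b \<in> S"
proof -
  obtain e where e: "e > 0" "cball a e \<subseteq> S" using assms open_contains_cball by blast
  show ?thesis
    by (rule that[of "e / 2"]) (use e in \<open>auto simp: dist_real_def abs_minus_commute subset_iff\<close>)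
qed

context
  fixes M :: "real measure" and S :: "real set" and f :: "real \<Rightarrow> real"
  assumes sets_M [measurable_cong]: "sets M = sets borel" and S: "open S" and lap: "has_laplace M S f"
begin

lemma integrable_moment_bound:
  assumes "\<theta> + 2 * d \<in> S" "\<theta> - 2 * d \<in> S"
  shows "integrable M (\<lambda>x. C * (exp ((\<theta> + 2 * d) * x) + exp ((\<theta> - 2 * d) * x)))"
  using has_laplaceD(1)[OF lap assms(1)] has_laplaceD(1)[OF lap assms(2)] by auto

lemma integrable_complex_moment:
  assumes "Re z \<in> S"
  shows "integrable M (\<lambda>x. complex_of_real x ^ k * exp (z * of_real x))"
proof -
  obtain d where d: "d > 0" "\<And>b. \<bar>b - Re z\<bar> \<le> 2 * d \<Longrightarrow> b \<in> S"
    using open_real_radius[OF S assms] by blast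
  show ?thesis
    by (rule Bochner_Integration.integrable_bound
        [OF integrable_moment_bound[of "Re z" d "fact k / d ^ k"]])
      (use d abs_power_exp_le[OF d(1), of "Re z" "Re z" _ k] in
        \<open>auto simp: norm_mult norm_power intro!: AE_I2 order.trans[OF _ abs_ge_self]\<close>)
qed

text \<open>The modulus of exp(z x) depends only on \<open>Re z\<close>, which moves by less than
  \<open>d\<close> over the ball, so the real bound for the moment of order \<open>k + 2\<close>
  dominates the second derivative.\<close>

lemma complex_moment_has_derivative:
  assumes "Re z \<in> S"
  shows "((\<lambda>z. \<integral>x. complex_of_real x ^ k * exp (z * of_real x) \<partial>M) has_field_derivative
    (\<integral>x. complex_of_real x ^ Suc k * exp (z * of_real x) \<partial>M)) (at z)"
proof -
  obtain d where d: "d > 0" "\<And>b. \<bar>b - Re z\<bar> \<le> 2 * d \<Longrightarrow> b \<in> S"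
    using open_real_radius[OF S assms] by blast
  have Re: "\<bar>Re w - Re z\<bar> \<le> d" if "w \<in> ball z d" for w
    using that abs_Re_le_cmod[of "w - z"] by (auto simp: dist_norm norm_minus_commute)
  show ?thesis
  proof (rule has_field_derivative_integral_of_bounded_second
      [where F'' = "\<lambda>z x. complex_of_real x ^ Suc (Suc k) * exp (z * of_real x)", OF d(1)])
    show "integrable M (\<lambda>x. complex_of_real x ^ k * exp (w * of_real x))" if "w \<in> ball z d" for w
    proof (intro integrable_complex_moment d(2))
      show "\<bar>Re w - Re z\<bar> \<le> 2 * d" using Re[OF that] d(1) by linarith
    qed
    show "integrable M (\<lambda>x. complex_of_real x ^ Suc k * exp (z * of_real x))"
      by (intro integrable_complex_moment assms)
    show "integrable M (\<lambda>x. fact (Suc (Suc k)) / d ^ Suc (Suc k)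
        * (exp ((Re z + 2 * d) * x) + exp ((Re z - 2 * d) * x)))"
      by (rule integrable_moment_bound) (use d in auto)
    show "((\<lambda>z. complex_of_real x ^ j * exp (z * of_real x)) has_field_derivative
        complex_of_real x ^ Suc j * exp (w * of_real x)) (at w)" for w x j
      by (rule derivative_eq_intros refl)+ simp
    then show "((\<lambda>z. complex_of_real x ^ Suc k * exp (z * of_real x)) has_field_derivative
        complex_of_real x ^ Suc (Suc k) * exp (w * of_real x)) (at w)" for w x .
    show "norm (complex_of_real x ^ Suc (Suc k) * exp (w * of_real x)) \<le> fact (Suc (Suc k)) / d ^ Suc (Suc k)
        * (exp ((Re z + 2 * d) * x) + exp ((Re z - 2 * d) * x))" if "w \<in> ball z d" for w x
      using abs_power_exp_le[OF d(1) Re[OF that], of x "Suc (Suc k)"]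
      by (simp add: norm_mult norm_power del: power_Suc fact_Suc)
  qed
qed

lemma integrable_moment:
  assumes "\<theta> \<in> S"
  shows "integrable M (\<lambda>x. x ^ k * exp (\<theta> * x))"
proof -
  have "integrable M (\<lambda>x. Re (complex_of_real x ^ k * exp (of_real \<theta> * of_real x)))"
    by (intro integrable_Re integrable_complex_moment) (simp add: assms)
  then show ?thesis
    by (simp add: of_real_mult[symmetric] exp_of_real of_real_power[symmetric] del: of_real_mult of_real_power)
qed

lemma moment_has_derivative:
  assumes "\<theta> \<in> S"
  shows "((\<lambda>\<theta>. \<integral>x. x ^ k * exp (\<theta> * x) \<partial>M) has_field_derivative
    (\<integral>x. x ^ Suc k * exp (\<theta> * x) \<partial>M)) (at \<theta>)"
proof -
  have eq: "(\<integral>x. complex_of_real x ^ k * exp (of_real \<theta> * of_real x) \<partial>M)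
    = of_real (\<integral>x. x ^ k * exp (\<theta> * x) \<partial>M)" for k \<theta>
    by (subst integral_complex_of_real[symmetric]) (simp flip: exp_of_real)
  have "((\<lambda>z. \<integral>x. complex_of_real x ^ k * exp (z * of_real x) \<partial>M) has_field_derivative
    (\<integral>x. complex_of_real x ^ Suc k * exp (of_real \<theta> * of_real x) \<partial>M)) (at (of_real \<theta>))"
    by (intro complex_moment_has_derivative) (simp add: assms)
  from has_vector_derivative_real_field[OF this]
  have "((\<lambda>\<theta>. complex_of_real (\<integral>x. x ^ k * exp (\<theta> * x) \<partial>M)) has_vector_derivative
     of_real (\<integral>x. x ^ Suc k * exp (\<theta> * x) \<partial>M)) (at \<theta>)"
    by (simp only: eq)
  then show ?thesis
    by (simp add: has_vector_derivative_complex_iff has_real_derivative_iff_has_vector_derivative)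
qed

end

text \<open>The Laplace transform extends holomorphically to the strip over \<open>S\<close>, and its restriction to
  the imaginary axis is the characteristic function.\<close>

lemma has_laplace_unique:
  assumes M: "real_distribution M" and N: "real_distribution N"
    and S: "open S" "convex S" "0 \<in> S" and lM: "has_laplace M S f" and lN: "has_laplace N S f"
  shows "M = N"
proof (rule Levy_uniqueness[OF M N], rule ext)
  fix t :: real
  interpret M: real_distribution M by fact
  interpret N: real_distribution N by fact
  \<comment> \<open>The power \<open>0\<close> is kept so that the derivative rule for complex
    moments applies literally.\<close>
  define G where "G = (\<lambda>M z. \<integral>x. complex_of_real x ^ 0 * exp (z * of_real x) \<partial>M)"
  define T where "T = Re -` S"
  have T: "open T" unfolding T_def by (intro open_vimage S continuous_intros)
  have "convex T" unfolding T_def using S(2)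
    by (intro convex_linear_vimage) (auto intro: bounded_linear.linear bounded_linear_Re)
  then have Tc: "connected T" by (rule convex_connected)
  have hol: "G M holomorphic_on T" "G N holomorphic_on T"
    using complex_moment_has_derivative[OF M.events_eq_borel S(1) lM]
      complex_moment_has_derivative[OF N.events_eq_borel S(1) lN]
    unfolding G_def T_def holomorphic_on_def field_differentiable_def
    by (blast intro: has_field_derivative_at_within)+
  have "G M (\<i> * t) - G N (\<i> * t) = 0"
  \<comment> \<open>Identity theorem: the transforms agree at the real points of \<open>S\<close>,
    which accumulate at \<open>0\<close>. The strip \<open>T\<close> is connected because
    \<open>S\<close> is convex, and contains the imaginary axis because \<open>0\<close> lies in
    \<open>S\<close>.\<close>
  proof (rule analytic_continuation[of "\<lambda>z. G M z - G N z" T "of_real ` S" 0])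
    show "of_real ` S \<subseteq> T" by (auto simp: T_def)
    show "0 islimpt complex_of_real ` S"
    proof (subst islimpt_approachable, intro allI impI)
      fix e :: real assume "e > 0"
      obtain d where d: "d > 0" "\<And>b. \<bar>b - 0\<bar> \<le> 2 * d \<Longrightarrow> b \<in> S"
        using open_real_radius[OF S(1,3)] by blast
      then show "\<exists>x'\<in>complex_of_real ` S. x' \<noteq> 0 \<and> dist x' 0 < e"
        using \<open>e > 0\<close> by (intro bexI[of _ "of_real (min d (e / 2))"] imageI d(2)) auto
    qed
    fix z assume "z \<in> complex_of_real ` S"
    then obtain \<theta> where \<theta>: "\<theta> \<in> S" "z = of_real \<theta>" by auto
    have "(\<integral>x. exp (of_real \<theta> * complex_of_real x) \<partial>K) = of_real (\<integral>x. exp (\<theta> * x) \<partial>K)" for K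
      by (subst integral_complex_of_real[symmetric]) (simp flip: exp_of_real)
    then show "G M z - G N z = 0"
      using has_laplaceD(2)[OF lM \<theta>(1)] has_laplaceD(2)[OF lN \<theta>(1)] by (simp add: G_def \<theta>(2))
  qed (use hol T Tc S in \<open>auto simp: T_def intro!: holomorphic_intros\<close>)
  then show "char M t = char N t"
    by (simp add: G_def char_def mult_ac)
qed

section \<open>Limits of Laplace transforms\<close>

text \<open>An exponential Markov inequality: exp(d x) + exp(-d x) dominates exp(d |x|), and its
  expectations converge, hence are bounded uniformly in \<open>n\<close>.\<close>

lemma tight_of_has_laplace:
  fixes P :: "nat \<Rightarrow> real measure"
  assumes P: "\<And>n. real_distribution (P n)" and S: "open S" "0 \<in> S"
    and lap: "\<And>n. has_laplace (P n) S (f n)"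
    and lim: "\<And>\<theta>. \<theta> \<in> S \<Longrightarrow> (\<lambda>n. f n \<theta>) \<longlonglongrightarrow> g \<theta>"
  shows "tight P"
  unfolding tight_def
proof (intro conjI allI impI P)
  fix \<epsilon> :: real assume \<epsilon>: "\<epsilon> > 0"
  obtain d where d: "d > 0" "\<And>b. \<bar>b - 0\<bar> \<le> 2 * d \<Longrightarrow> b \<in> S"
    using open_real_radius[OF S] by blast
  have dS: "d \<in> S" "- d \<in> S" using d by auto
  have "convergent (\<lambda>n. f n d + f n (- d))"
    using tendsto_add[OF lim lim, OF dS] by (auto simp: convergent_def)
  from convergent_imp_Bseq[OF this] obtain C
    where C: "C > 0" "\<And>n. norm (f n d + f n (- d)) \<le> C"
    unfolding Bseq_def by blast
  \<comment> \<open>Solves \<open>C / exp (d * R) < \<epsilon>\<close>: the summand \<open>1\<close>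
    makes the inequality strict, and the maximum with \<open>1\<close> makes the interval
    non-empty.\<close>
  define R where "R = max 1 (ln (C / \<epsilon>) / d + 1)"
  have "ln (C / \<epsilon>) + d \<le> d * R"
    using d(1) mult_left_mono[of "ln (C / \<epsilon>) / d + 1" R d] by (simp add: R_def distrib_left)
  then have "ln (C / \<epsilon>) < d * R" using d(1) by linarith
  then have "C / \<epsilon> < exp (d * R)" using C(1) \<epsilon> by (metis divide_pos_pos exp_less_cancel_iff exp_ln)
  then have R: "C / exp (d * R) < \<epsilon>" using \<epsilon> by (simp add: field_simps)
  have R0: "R > 0" by (simp add: R_def)
  show "\<exists>a b. a < b \<and> (\<forall>n. 1 - \<epsilon> < measure (P n) {a<..b})"
  proof (rule exI[of _ "- R"], rule exI[of _ R], intro conjI allI)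
    fix n
    interpret real_distribution "P n" by (rule P)
    define u where "u = (\<lambda>x. exp (d * x) + exp (- d * x))"
    have u: "integrable (P n) u" "(\<integral>x. u x \<partial>P n) = f n d + f n (- d)"
      using has_laplaceD[OF lap dS(1), of n] has_laplaceD[OF lap dS(2), of n] by (auto simp: u_def)
    have "measure (P n) (UNIV - {- R<..R}) \<le> measure (P n) {x \<in> space (P n). u x \<ge> exp (d * R)}"
    proof (rule finite_measure_mono)
      show "UNIV - {- R<..R} \<subseteq> {x \<in> space (P n). u x \<ge> exp (d * R)}"
      proof safe
        fix x assume "x \<notin> {- R<..R}"
        then have "R \<le> \<bar>x\<bar>" by auto
        then have "exp (d * R) \<le> exp (d * \<bar>x\<bar>)" using d by auto
        from this exp_abs_le show "exp (d * R) \<le> u x" unfolding u_def by (rule order.trans)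
      qed auto
    qed (simp add: u_def)
    also have "\<dots> \<le> (\<integral>x. u x \<partial>P n) / exp (d * R)"
      by (rule integral_Markov_inequality_measure[OF u(1), of "{}"])
        (auto simp: u_def intro!: AE_I2 add_nonneg_nonneg)
    also have "\<dots> \<le> C / exp (d * R)"
      using C(2)[of n] by (intro divide_right_mono) (auto simp: u(2))
    finally have "measure (P n) (UNIV - {- R<..R}) < \<epsilon>" using R by linarith
    moreover have "measure (P n) (UNIV - {- R<..R}) = 1 - measure (P n) {- R<..R}"
      using prob_compl[of "{- R<..R}"] by simp
    ultimately show "1 - \<epsilon> < measure (P n) {- R<..R}" by simp
  qed (use R0 in simp)
qed

text \<open>A slightly larger exponent \<open>\<theta> + \<eta> * \<theta>\<close> controls the error of truncating
  \<open>exp (\<theta> * x)\<close> at level \<open>exp k\<close>, uniformly along the sequence.\<close>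

lemma has_laplace_limit:
  fixes P :: "nat \<Rightarrow> real measure"
  assumes P: "\<And>n. real_distribution (P n)" and S: "open S" "0 \<in> S"
    and lap: "\<And>n. has_laplace (P n) S (f n)"
    and lim: "\<And>\<theta>. \<theta> \<in> S \<Longrightarrow> (\<lambda>n. f n \<theta>) \<longlonglongrightarrow> g \<theta>"
  obtains Q where "real_distribution Q" "has_laplace Q S g"
proof -
  have "tight P" using assms by (rule tight_of_has_laplace)
  \<comment> \<open>One subsequence suffices, because the transforms converge to \<open>g\<close>
    along the full sequence and so along this one.\<close>
  from tight_imp_convergent_subsubsequence[OF this, of id]
  obtain r Q where r: "strict_mono r" and Q: "real_distribution Q"
    and conv: "weak_conv_m (P \<circ> r) Q"
    by (auto simp: strict_mono_id)
  interpret Q: real_distribution Q by fact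
  have "has_bochner_integral Q (\<lambda>x. exp (\<theta> * x)) (g \<theta>)" if \<theta>: "\<theta> \<in> S" for \<theta>
  proof -
    obtain d where d: "d > 0" "\<And>b. \<bar>b - \<theta>\<bar> \<le> 2 * d \<Longrightarrow> b \<in> S"
      using open_real_radius[OF S(1) \<theta>] by blast
    \<comment> \<open>Keeps \<open>\<eta> * \<theta>\<close> within the radius on which exponents
      stay in \<open>S\<close>; the \<open>+ 1\<close> covers \<theta> = 0.\<close>
    define \<eta> where "\<eta> = d / (\<bar>\<theta>\<bar> + 1)"
    have \<eta>: "\<eta> > 0" using d(1) by (simp add: \<eta>_def)
    have "d * \<bar>\<theta>\<bar> \<le> 2 * d * (\<bar>\<theta>\<bar> + 1)" using d(1) by (intro mult_mono) auto
    then have "\<bar>\<eta> * \<theta>\<bar> \<le> 2 * d" using d(1) by (simp add: \<eta>_def abs_mult field_simps)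
    then have \<theta>': "\<theta> + \<eta> * \<theta> \<in> S" by (intro d(2)) simp
    \<comment> \<open>Truncation in the exponent keeps the test function continuous, bounded and
      increasing in \<open>k\<close>.\<close>
    define F where "F = (\<lambda>k x. exp (min (\<theta> * x) (real k)))"
    have contF: "isCont (F k) x" for k x
      unfolding F_def by (intro continuous_intros)
    have boundF: "norm (F k x) \<le> exp (real k)" for k x by (simp add: F_def)
    have measF: "F k \<in> borel_measurable borel" for k by (simp add: F_def)
    have intF: "integrable M (F k)" if "real_distribution M" for M k
    proof -
      interpret real_distribution M by fact
      show ?thesis by (rule integrable_const_bound[where B="exp k"]) (use boundF measF in auto)
    qed
    have L: "(\<lambda>n. \<integral>x. F k x \<partial>P (r n)) \<longlonglongrightarrow> (\<integral>x. F k x \<partial>Q)" for k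
      using weak_conv_imp_integral_bdd_continuous_conv[OF _ Q conv contF boundF] P
      by (simp add: o_def)
    have limr: "(\<lambda>n. f (r n) t) \<longlonglongrightarrow> g t" if "t \<in> S" for t
      using LIMSEQ_subseq_LIMSEQ[OF lim[OF that] r] by (simp add: o_def)
    have up: "(\<integral>x. F k x \<partial>P n) \<le> f n \<theta>" for k n
      unfolding has_laplaceD(2)[OF lap \<theta>, symmetric]
      by (rule integral_mono) (auto simp: F_def intro: intF[OF P, unfolded F_def] has_laplaceD[OF lap \<theta>])
    have lo: "f n \<theta> - exp (- \<eta> * k) * f n (\<theta> + \<eta> * \<theta>) \<le> (\<integral>x. F k x \<partial>P n)" for k n
    proof -
      have "f n \<theta> - exp (- \<eta> * k) * f n (\<theta> + \<eta> * \<theta>)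
          = (\<integral>x. exp (\<theta> * x) - exp (- \<eta> * k) * exp ((\<theta> + \<eta> * \<theta>) * x) \<partial>P n)"
        using has_laplaceD[OF lap \<theta>, of n] has_laplaceD[OF lap \<theta>', of n] by simp
      also have "\<dots> \<le> (\<integral>x. F k x \<partial>P n)"
      proof (rule integral_mono)
        fix x
        show "exp (\<theta> * x) - exp (- \<eta> * k) * exp ((\<theta> + \<eta> * \<theta>) * x) \<le> F k x"
        proof (cases "\<theta> * x \<le> k")
          case False
          then have "\<theta> * x \<le> \<theta> * x + \<eta> * (\<theta> * x - k)" using \<eta> by simp
          also have "\<dots> = - \<eta> * k + (\<theta> + \<eta> * \<theta>) * x" by (simp add: algebra_simps)
          finally have "exp (\<theta> * x) \<le> exp (- \<eta> * k) * exp ((\<theta> + \<eta> * \<theta>) * x)"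
            by (simp only: exp_add[symmetric] exp_le_cancel_iff)
          moreover have "0 \<le> F k x" by (simp add: F_def)
          ultimately show ?thesis by linarith
        qed (simp add: F_def)
      qed (use has_laplaceD[OF lap \<theta>, of n] has_laplaceD[OF lap \<theta>', of n] intF[OF P] in auto)
      finally show ?thesis .
    qed
    have upQ: "(\<integral>x. F k x \<partial>Q) \<le> g \<theta>" for k
      by (rule LIMSEQ_le[OF L limr[OF \<theta>]]) (use up in auto)
    have loQ: "g \<theta> - exp (- \<eta> * k) * g (\<theta> + \<eta> * \<theta>) \<le> (\<integral>x. F k x \<partial>Q)" for k :: nat
      by (rule LIMSEQ_le[OF tendsto_diff[OF limr[OF \<theta>] tendsto_mult_left[OF limr[OF \<theta>']]] L])
        (use lo in blast)
    have "filterlim (\<lambda>k::nat. \<eta> * real k) at_top sequentially"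
      using \<eta> by (intro filterlim_tendsto_pos_mult_at_top[OF tendsto_const] filterlim_real_sequentially)
    then have "(\<lambda>k::nat. exp (- \<eta> * real k)) \<longlonglongrightarrow> 0"
      by (intro filterlim_compose[OF exp_at_bot]) (simp add: filterlim_uminus_at_bot)
    then have "(\<lambda>k::nat. g \<theta> - exp (- \<eta> * real k) * g (\<theta> + \<eta> * \<theta>)) \<longlonglongrightarrow> g \<theta> - 0 * g (\<theta> + \<eta> * \<theta>)"
      by (intro tendsto_intros)
    then have limK: "(\<lambda>k. \<integral>x. F k x \<partial>Q) \<longlonglongrightarrow> g \<theta>"
      by (intro real_tendsto_sandwich[OF always_eventually[OF allI[OF loQ]]
          always_eventually[OF allI[OF upQ]] _ tendsto_const]) simp
    show ?thesis
    \<comment> \<open>Monotone convergence yields both the value \<open>g \<theta>\<close> and the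
      integrability of the untruncated exponential under \<open>Q\<close>.\<close>
    proof (rule has_bochner_integral_monotone_convergence[OF intF[OF Q] _ _ limK])
      show "AE x in Q. mono (\<lambda>k. F k x)" by (auto simp: F_def mono_def intro!: AE_I2)
      show "AE x in Q. (\<lambda>k. F k x) \<longlonglongrightarrow> exp (\<theta> * x)"
      proof (rule AE_I2, rule tendsto_eventually)
        fix x
        show "\<forall>\<^sub>F k in sequentially. F k x = exp (\<theta> * x)"
          using eventually_ge_at_top[of "nat \<lceil>\<theta> * x\<rceil>"] by eventually_elim (auto simp: F_def)
      qed
    qed simp
  qed
  then show thesis using Q that by (auto simp: has_laplace_def)
qed

section \<open>Convolution and compound Poisson laws\<close>

text \<open>In extended non-negative reals, products and powers of transforms need no integrability
  side conditions. The clause \<open>0 \<le> f \<theta>\<close> is essential there, as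
  \<open>ennreal\<close> sends negative numbers to \<open>0\<close>.\<close>

lemma has_laplace_nn_integral:
  assumes [measurable_cong]: "sets M = sets borel"
  shows "has_laplace M S f \<longleftrightarrow>
    (\<forall>\<theta>\<in>S. 0 \<le> f \<theta> \<and> (\<integral>\<^sup>+x. ennreal (exp (\<theta> * x)) \<partial>M) = ennreal (f \<theta>))"
proof -
  have "has_bochner_integral M (\<lambda>x. exp (\<theta> * x)) v \<longleftrightarrow>
      0 \<le> v \<and> (\<integral>\<^sup>+x. ennreal (exp (\<theta> * x)) \<partial>M) = ennreal v" for \<theta> v
  proof
    assume "has_bochner_integral M (\<lambda>x. exp (\<theta> * x)) v"
    then show "0 \<le> v \<and> (\<integral>\<^sup>+x. ennreal (exp (\<theta> * x)) \<partial>M) = ennreal v"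
      by (auto simp: has_bochner_integral_iff nn_integral_eq_integral)
  qed (intro has_bochner_integral_nn_integral; auto)
  then show ?thesis by (simp add: has_laplace_def)
qed

lemma nn_integral_exp_convolution:
  assumes "finite_measure M" and M [measurable_cong]: "sets M = sets borel"
    and "finite_measure N" and N [measurable_cong]: "sets N = sets borel"
  shows "(\<integral>\<^sup>+x. ennreal (exp (\<theta> * x)) \<partial>(M \<star> N))
    = (\<integral>\<^sup>+x. ennreal (exp (\<theta> * x)) \<partial>M) * (\<integral>\<^sup>+x. ennreal (exp (\<theta> * x)) \<partial>N)"
  by (subst nn_integral_convolution[OF assms(1,3) N M])
    (auto simp: distrib_left exp_add ennreal_mult nn_integral_cmult nn_integral_multc)

lemma has_laplace_convolution:
  assumes M: "finite_measure M" "sets M = sets borel" "has_laplace M S f"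
    and N: "finite_measure N" "sets N = sets borel" "has_laplace N S g"
  shows "has_laplace (M \<star> N) S (\<lambda>\<theta>. f \<theta> * g \<theta>)"
  using M(3) N(3) nn_integral_exp_convolution[OF M(1,2) N(1,2)]
  by (auto simp: has_laplace_nn_integral M(2) N(2) ennreal_mult)

lemma real_distribution_convolution:
  assumes "real_distribution M" "real_distribution N"
  shows "real_distribution (M \<star> N)"
proof -
  interpret M: real_distribution M by fact
  interpret N: real_distribution N by fact
  interpret pair_prob_space M N ..
  show ?thesis unfolding convolution_def by (intro real_distribution_distr) simp
qed

lemma real_distribution_return: "real_distribution (return borel a)"
  by (simp add: real_distribution_def real_distribution_axioms_def prob_space_return)

lemma has_laplace_return: "has_laplace (return borel a) S (\<lambda>\<theta>. exp (\<theta> * a))"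
  by (simp add: has_laplace_nn_integral nn_integral_return)

lemma real_distribution_conv_power:
  "real_distribution M \<Longrightarrow> real_distribution (conv_power n M)"
  by (induction n) (simp_all add: real_distribution_return real_distribution_convolution)

lemma real_distribution_finite_measure: "real_distribution M \<Longrightarrow> finite_measure M"
  by (simp add: real_distribution_def prob_space_def)

lemma nn_integral_exp_conv_power:
  assumes "real_distribution M"
  shows "(\<integral>\<^sup>+x. ennreal (exp (\<theta> * x)) \<partial>conv_power n M) = (\<integral>\<^sup>+x. ennreal (exp (\<theta> * x)) \<partial>M) ^ n"
proof (induction n)
  case 0
  then show ?case by (simp add: nn_integral_return)
next
  case (Suc n)
  have "real_distribution (conv_power n M)" using assms by (rule real_distribution_conv_power)
  with assms show ?case
    by (simp add: Suc nn_integral_exp_convolution real_distribution_finite_measure real_distribution.events_eq_borel)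
qed

lemma has_laplace_conv_power:
  assumes "real_distribution M" and "has_laplace M S f"
  shows "has_laplace (conv_power n M) S (\<lambda>\<theta>. f \<theta> ^ n)"
  using assms
  by (auto simp: has_laplace_nn_integral real_distribution.events_eq_borel real_distribution_conv_power
      nn_integral_exp_conv_power ennreal_power)

text \<open>A Poisson number of independent jumps: conditioning on the number leaves the exponential
  series in \<open>r * c\<close>. The exponent is a single point, so that \<theta> = 0 can later be
  used on its own.\<close>

lemma nn_integral_exp_poisson_bind:
  assumes r: "r > 0" and M: "real_distribution M" and lap: "has_laplace M {\<theta>} (\<lambda>_. c)"
  shows "(\<integral>\<^sup>+x. ennreal (exp (\<theta> * x)) \<partial>(measure_pmf (poisson_pmf r) \<bind> (\<lambda>n. conv_power n M)))
    = ennreal (exp (r * c - r))"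
proof -
  have c: "0 \<le> c"
    using lap by (simp add: has_laplace_nn_integral real_distribution.events_eq_borel[OF M])
  have pow: "(\<integral>\<^sup>+x. ennreal (exp (\<theta> * x)) \<partial>conv_power n M) = ennreal (c ^ n)" for n
    using has_laplace_conv_power[OF M lap, of n]
    by (simp add: has_laplace_nn_integral real_distribution.events_eq_borel[OF real_distribution_conv_power[OF M]])
  have meas: "(\<lambda>n. conv_power n M) \<in> measure_pmf (poisson_pmf r) \<rightarrow>\<^sub>M subprob_algebra borel"
    using real_distribution_conv_power[OF M]
    by (auto simp: space_subprob_algebra real_distribution.events_eq_borel real_distribution_def
        prob_space_imp_subprob_space)
  have sums: "(\<lambda>n. r ^ n / fact n * exp (- r) * c ^ n) sums exp (r * c - r)"
    using sums_mult[OF exp_converges[of "r * c"], of "exp (- r)"]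
    by (simp add: exp_diff exp_minus field_simps power_mult_distrib)
  have "(\<integral>\<^sup>+x. ennreal (exp (\<theta> * x)) \<partial>(measure_pmf (poisson_pmf r) \<bind> (\<lambda>n. conv_power n M)))
      = (\<integral>\<^sup>+n. ennreal (c ^ n) \<partial>measure_pmf (poisson_pmf r))"
    by (subst nn_integral_bind[OF _ meas]) (simp_all add: pow)
  also have "\<dots> = (\<Sum>n. ennreal (r ^ n / fact n * exp (- r) * c ^ n))"
    using r c
    by (simp add: nn_integral_measure_pmf nn_integral_count_space_nat ennreal_mult[symmetric])
  also have "\<dots> = ennreal (exp (r * c - r))"
    using sums r c by (subst suminf_ennreal2) (auto simp: sums_iff)
  finally show ?thesis .
qed

text \<open>The mass of \<open>M\<close> is the jump intensity, its normalisation the jump law, and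
  convolution with a Dirac mass adds the drift. A null \<open>M\<close> cannot be normalised and
  leaves only the drift.\<close>

lemma compound_poisson_exists:
  fixes M :: "real measure"
  assumes M: "finite_measure M" "sets M = sets borel" and lap: "has_laplace M S f"
  obtains P where "real_distribution P"
    "has_laplace P S (\<lambda>\<theta>. exp (\<theta> * a + (f \<theta> - measure M UNIV)))"
proof (cases "measure M UNIV = 0")
  case True
  interpret finite_measure M by fact
  note [measurable_cong] = M(2)
  have sp: "space M = UNIV" using sets_eq_imp_space_eq[OF M(2)] by simp
  have "AE x in M. False"
    by (rule AE_I[of _ _ UNIV]) (use True M sp in \<open>auto simp: emeasure_eq_measure\<close>)
  then have "(\<integral>x. exp (\<theta> * x) \<partial>M) = 0" for \<theta>
    by (intro integral_eq_zero_AE) auto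
  then have "f \<theta> = 0" if "\<theta> \<in> S" for \<theta> using has_laplaceD(2)[OF lap that] by simp
  then have "has_laplace (return borel a) S (\<lambda>\<theta>. exp (\<theta> * a + (f \<theta> - measure M UNIV)))"
    using has_laplace_return[of a S] True by (simp add: has_laplace_def)
  then show ?thesis using that real_distribution_return by blast
next
  case False
  interpret finite_measure M by fact
  note [measurable_cong] = M(2)
  have sp: "space M = UNIV" using sets_eq_imp_space_eq[OF M(2)] by simp
  define r where "r = measure M UNIV"
  have r: "r > 0" using False zero_less_measure_iff[of M UNIV] by (simp add: r_def)
  define N where "N = scale_measure (ennreal (1 / r)) M"
  have "emeasure N UNIV = ennreal (1 / r) * ennreal r"
    by (simp add: N_def emeasure_eq_measure r_def)
  also have "\<dots> = 1" using r by (simp add: ennreal_mult[symmetric])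
  finally have N: "real_distribution N"
    by (auto simp: real_distribution_def real_distribution_axioms_def N_def M(2) sp space_scale_measure intro!: prob_spaceI)
  define P where "P = measure_pmf (poisson_pmf r) \<bind> (\<lambda>n. conv_power n N)"
  have sets_P: "sets P = sets borel"
    unfolding P_def using real_distribution.events_eq_borel[OF real_distribution_conv_power[OF N]]
    by (intro sets_bind) auto
  have nnP: "(\<integral>\<^sup>+x. ennreal (exp (\<theta> * x)) \<partial>P) = ennreal (exp (r * c - r))"
    if "has_laplace N {\<theta>} (\<lambda>_. c)" for \<theta> c
    unfolding P_def by (rule nn_integral_exp_poisson_bind[OF r N that])
  have lapN: "has_laplace N {\<theta>} (\<lambda>_. f \<theta> / r)" if "\<theta> \<in> S" for \<theta>
    using lap that r
    by (auto simp: has_laplace_nn_integral N_def M(2) nn_integral_scale_measure ennreal_mult[symmetric])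
  \<comment> \<open>The exponent \<open>0\<close> shows that the mixture has total mass one.\<close>
  have "has_laplace N {0} (\<lambda>_. 1)"
    using prob_space.emeasure_space_1[of N] N
    by (simp add: has_laplace_nn_integral real_distribution.events_eq_borel real_distribution_def)
  from nnP[OF this] have "emeasure P (space P) = 1" by simp
  then have P: "real_distribution P"
    by (auto simp: real_distribution_def real_distribution_axioms_def sets_P intro!: prob_spaceI)
  have lapP: "has_laplace P S (\<lambda>\<theta>. exp (f \<theta> - r))"
    using nnP[OF lapN] r by (simp add: has_laplace_nn_integral[OF sets_P])
  have "has_laplace (return borel a \<star> P) S (\<lambda>\<theta>. exp (\<theta> * a) * exp (f \<theta> - r))"
    by (intro has_laplace_convolution lapP has_laplace_return real_distribution_finite_measure
        real_distribution.events_eq_borel P real_distribution_return)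
  then show ?thesis
    by (intro that[of "return borel a \<star> P"] real_distribution_convolution real_distribution_return P)
      (simp add: exp_add r_def)
qed

section \<open>Kolmogorov's canonical representation\<close>

text \<open>The value at \<open>0\<close> is the continuous
  extension, so that an atom of the representing measure at \<open>0\<close> produces the Gaussian part.\<close>

definition kolmogorov_kernel :: "real \<Rightarrow> real \<Rightarrow> real" where
  "kolmogorov_kernel \<theta> x = (if x = 0 then \<theta>\<^sup>2 / 2 else (exp (\<theta> * x) - 1 - \<theta> * x) / x\<^sup>2)"

definition kolmogorov_kernel' :: "real \<Rightarrow> real \<Rightarrow> real" where
  "kolmogorov_kernel' \<theta> x = (if x = 0 then \<theta> else (exp (\<theta> * x) - 1) / x)"

lemma kolmogorov_kernel_measurable [measurable]:
  "kolmogorov_kernel \<theta> \<in> borel_measurable borel" "kolmogorov_kernel' \<theta> \<in> borel_measurable borel"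
proof -
  have "(\<lambda>x. if x = 0 then \<theta>\<^sup>2 / 2 else (exp (\<theta> * x) - 1 - \<theta> * x) / x\<^sup>2) \<in> borel_measurable borel"
    "(\<lambda>x. if x = 0 then \<theta> else (exp (\<theta> * x) - 1) / x) \<in> borel_measurable borel"
    by measurable
  then show "kolmogorov_kernel \<theta> \<in> borel_measurable borel" "kolmogorov_kernel' \<theta> \<in> borel_measurable borel"
    by (simp_all add: kolmogorov_kernel_def[abs_def] kolmogorov_kernel'_def[abs_def])
qed

lemma kolmogorov_kernel_zero [simp]: "kolmogorov_kernel 0 x = 0" "kolmogorov_kernel' 0 x = 0"
  by (simp_all add: kolmogorov_kernel_def kolmogorov_kernel'_def)

text \<open>For each fixed \<open>x\<close>, including \<open>0\<close>, the kernels are the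
  successive antiderivatives of exp(\<theta> x) in \<theta> that vanish at \<theta> = 0.\<close>

lemma kolmogorov_kernel_derivative:
  "((\<lambda>\<theta>. kolmogorov_kernel \<theta> x) has_field_derivative kolmogorov_kernel' \<theta> x) (at \<theta>)"
  "((\<lambda>\<theta>. kolmogorov_kernel' \<theta> x) has_field_derivative exp (\<theta> * x)) (at \<theta>)"
  unfolding kolmogorov_kernel_def kolmogorov_kernel'_def
  by (cases "x = 0"; auto intro!: derivative_eq_intros simp: field_simps power2_eq_square)+

text \<open>The tangent inequality at \<open>u\<close> and at \<open>- u\<close> encloses
  \<open>exp u - 1\<close> between \<open>u\<close> and \<open>u * exp u\<close>. The bound is crude
  but involves no exponential other than \<open>exp u\<close>, so that after setting u = \<theta> x
  it is integrable wherever the transform exists.\<close>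

lemma abs_exp_minus_one_le: "\<bar>exp u - 1\<bar> \<le> \<bar>u\<bar> * (1 + exp u)" for u :: real
proof -
  have "1 - u \<le> exp (- u)" using exp_ge_add_one_self[of "- u"] by simp
  then have "(1 - u) * exp u \<le> exp (- u) * exp u" by (intro mult_right_mono) auto
  then have 1: "exp u - 1 \<le> u * exp u" by (simp add: exp_minus algebra_simps)
  have 2: "u \<le> exp u - 1" using exp_ge_add_one_self[of u] by linarith
  show ?thesis
  proof (cases "u \<ge> 0")
    case True
    then show ?thesis using 1 2 by (simp add: algebra_simps)
  next
    case False
    then have "u * exp u \<le> 0" by (simp add: mult_nonpos_nonneg)
    moreover have "\<bar>u\<bar> * (1 + exp u) = - u - u * exp u" using False by (simp add: algebra_simps)
    moreover have "\<bar>exp u - 1\<bar> = 1 - exp u" using False by simp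
    ultimately show ?thesis using 2 by linarith
  qed
qed

lemma abs_exp_minus_affine_le: "\<bar>exp u - 1 - u\<bar> \<le> u\<^sup>2 * (1 + exp u)" for u :: real
proof -
  have "1 - u \<le> exp (- u)" using exp_ge_add_one_self[of "- u"] by simp
  then have "(1 - u) * exp u \<le> exp (- u) * exp u" by (intro mult_right_mono) auto
  then have 1: "exp u - 1 - u \<le> u * (exp u - 1)" by (simp add: exp_minus algebra_simps)
  have "\<bar>exp u - 1 - u\<bar> = exp u - 1 - u" using exp_ge_add_one_self[of u] by linarith
  also have "\<dots> \<le> \<bar>u\<bar> * \<bar>exp u - 1\<bar>" using 1 by (metis abs_ge_self abs_mult order.trans)
  also have "\<dots> \<le> \<bar>u\<bar> * (\<bar>u\<bar> * (1 + exp u))" by (intro mult_left_mono abs_exp_minus_one_le) auto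
  finally show ?thesis by (simp add: power2_eq_square mult.assoc[symmetric])
qed

lemma kolmogorov_kernel_bound:
  "\<bar>kolmogorov_kernel \<theta> x\<bar> \<le> \<theta>\<^sup>2 * (1 + exp (\<theta> * x))"
  "\<bar>kolmogorov_kernel' \<theta> x\<bar> \<le> \<bar>\<theta>\<bar> * (1 + exp (\<theta> * x))"
proof -
  show "\<bar>kolmogorov_kernel \<theta> x\<bar> \<le> \<theta>\<^sup>2 * (1 + exp (\<theta> * x))"
    using abs_exp_minus_affine_le[of "\<theta> * x"]
    by (auto simp: kolmogorov_kernel_def field_simps power_mult_distrib)
  show "\<bar>kolmogorov_kernel' \<theta> x\<bar> \<le> \<bar>\<theta>\<bar> * (1 + exp (\<theta> * x))"
    using abs_exp_minus_one_le[of "\<theta> * x"]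
    by (auto simp: kolmogorov_kernel'_def field_simps abs_mult)
qed

lemma integrable_kolmogorov_kernel:
  assumes "finite_measure R" and [measurable_cong]: "sets R = sets borel"
    and "integrable R (\<lambda>x. exp (\<theta> * x))"
  shows "integrable R (kolmogorov_kernel \<theta>)" "integrable R (kolmogorov_kernel' \<theta>)"
proof -
  interpret finite_measure R by fact
  have *: "integrable R (\<lambda>x. c * (1 + exp (\<theta> * x)))" for c
    using assms(3) by auto
  show "integrable R (kolmogorov_kernel \<theta>)" "integrable R (kolmogorov_kernel' \<theta>)"
    by (rule Bochner_Integration.integrable_bound[OF *];
        auto intro!: AE_I2 order.trans[OF kolmogorov_kernel_bound(1) abs_ge_self]
          order.trans[OF kolmogorov_kernel_bound(2) abs_ge_self])+
qed

text \<open>The second derivatives of the two kernels in \<theta> are exp(\<theta> x) and x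
  exp(\<theta> x), dominated by the moment bounds of order 0 and 1.\<close>

lemma integral_kolmogorov_kernel_derivative:
  assumes R: "finite_measure R" "sets R = sets borel" and S: "open S"
    and lap: "has_laplace R S f" and \<theta>: "\<theta> \<in> S"
  shows "((\<lambda>\<theta>. \<integral>x. kolmogorov_kernel \<theta> x \<partial>R) has_field_derivative (\<integral>x. kolmogorov_kernel' \<theta> x \<partial>R)) (at \<theta>)"
    "((\<lambda>\<theta>. \<integral>x. kolmogorov_kernel' \<theta> x \<partial>R) has_field_derivative f \<theta>) (at \<theta>)"
proof -
  obtain d where d: "d > 0" "\<And>b. \<bar>b - \<theta>\<bar> \<le> 2 * d \<Longrightarrow> b \<in> S"
    using open_real_radius[OF S \<theta>] by blast
  have near: "\<bar>b - \<theta>\<bar> \<le> d" "integrable R (\<lambda>x. exp (b * x))" if "b \<in> ball \<theta> d" for b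
  proof -
    show *: "\<bar>b - \<theta>\<bar> \<le> d" using that by (auto simp: dist_real_def)
    show "integrable R (\<lambda>x. exp (b * x))"
      by (rule has_laplaceD(1)[OF lap d(2)]) (use * d(1) in linarith)
  qed
  have B: "integrable R (\<lambda>x. c * (exp ((\<theta> + 2 * d) * x) + exp ((\<theta> - 2 * d) * x)))" for c
    by (rule integrable_moment_bound[OF R(2) S lap]) (use d in auto)
  note int = integrable_kolmogorov_kernel[OF R]
  have \<theta>b: "\<theta> \<in> ball \<theta> d" using d by simp
  show "((\<lambda>\<theta>. \<integral>x. kolmogorov_kernel \<theta> x \<partial>R) has_field_derivative (\<integral>x. kolmogorov_kernel' \<theta> x \<partial>R)) (at \<theta>)"
  proof (rule has_field_derivative_integral_of_bounded_second[OF d(1) _ _ B])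
    show "norm (exp (b * x)) \<le> fact 0 / d ^ 0 * (exp ((\<theta> + 2 * d) * x) + exp ((\<theta> - 2 * d) * x))"
      if "b \<in> ball \<theta> d" for b x
      using abs_power_exp_le[OF d(1) near(1)[OF that], of x 0] by simp
  qed (use near \<theta>b in \<open>auto intro!: int kolmogorov_kernel_derivative\<close>)
  have "((\<lambda>\<theta>. \<integral>x. kolmogorov_kernel' \<theta> x \<partial>R) has_field_derivative (\<integral>x. exp (\<theta> * x) \<partial>R)) (at \<theta>)"
  proof (rule has_field_derivative_integral_of_bounded_second[OF d(1) _ _ B])
    show "((\<lambda>\<theta>. exp (\<theta> * x)) has_field_derivative x * exp (b * x)) (at b)" for b x
      by (auto intro!: derivative_eq_intros)
    show "norm (x * exp (b * x)) \<le> fact 1 / d ^ 1 * (exp ((\<theta> + 2 * d) * x) + exp ((\<theta> - 2 * d) * x))"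
      if "b \<in> ball \<theta> d" for b x
      using abs_power_exp_le[OF d(1) near(1)[OF that], of x 1] by (simp add: abs_mult)
  qed (use near \<theta>b in \<open>auto intro!: int kolmogorov_kernel_derivative\<close>)
  then show "((\<lambda>\<theta>. \<integral>x. kolmogorov_kernel' \<theta> x \<partial>R) has_field_derivative f \<theta>) (at \<theta>)"
    by (simp add: has_laplaceD(2)[OF lap \<theta>])
qed

text \<open>Functions with equal second derivatives on an interval differ by an affine function. The
  kernel integral and its derivative vanish at \<open>0\<close>, so this function is
  \<open>\<theta> * g' 0\<close>.\<close>

lemma kolmogorov_representation:
  assumes R: "finite_measure R" "sets R = sets borel" and S: "open S" "convex S" "0 \<in> S"
    and lap: "has_laplace R S f"
    and g: "\<And>\<theta>. \<theta> \<in> S \<Longrightarrow> (g has_field_derivative g' \<theta>) (at \<theta>)"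
    and g': "\<And>\<theta>. \<theta> \<in> S \<Longrightarrow> (g' has_field_derivative f \<theta>) (at \<theta>)"
    and g0: "g 0 = 0" and \<theta>: "\<theta> \<in> S"
  shows "g \<theta> = \<theta> * g' 0 + (\<integral>x. kolmogorov_kernel \<theta> x \<partial>R)"
proof -
  note D = integral_kolmogorov_kernel_derivative[OF R S(1) lap]
  obtain c where c: "\<And>t. t \<in> S \<Longrightarrow> g' t - (\<integral>x. kolmogorov_kernel' t x \<partial>R) = c"
  proof -
    have "((\<lambda>t. g' t - (\<integral>x. kolmogorov_kernel' t x \<partial>R)) has_field_derivative 0) (at t within S)"
      if "t \<in> S" for t
      using DERIV_diff[OF g'[OF that] D(2)[OF that]] by (simp add: has_field_derivative_at_within)
    from has_field_derivative_zero_constant[OF S(2) this] show thesis using that by blast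
  qed
  then have g'_eq: "g' t = g' 0 + (\<integral>x. kolmogorov_kernel' t x \<partial>R)" if "t \<in> S" for t
    using c[OF that] c[OF S(3)] by simp
  have zero: "((\<lambda>t. g t - (\<integral>x. kolmogorov_kernel t x \<partial>R) - g' 0 * t) has_field_derivative 0) (at t within S)"
    if t: "t \<in> S" for t
    using DERIV_diff[OF DERIV_diff[OF g[OF t] D(1)[OF t]] DERIV_cmult_Id[of "g' 0"]] g'_eq[OF t]
    by (simp add: has_field_derivative_at_within)
  obtain c' where c': "\<And>t. t \<in> S \<Longrightarrow> g t - (\<integral>x. kolmogorov_kernel t x \<partial>R) - g' 0 * t = c'"
    using has_field_derivative_zero_constant[OF S(2) zero] by blast
  show ?thesis using c'[OF \<theta>] c'[OF S(3)] g0 by (simp add: algebra_simps)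
qed

text \<open>Moving the mass in \<open>\<bar>x\<bar> < 1 / (n + 1)\<close> to the point \<open>1 / (n + 1)\<close> turns the Kolmogorov
  exponent into that of a shifted compound Poisson law.\<close>

definition push_away :: "nat \<Rightarrow> real \<Rightarrow> real" where
  "push_away n x = (if \<bar>x\<bar> < 1 / Suc n then 1 / Suc n else x)"

lemma push_away_measurable [measurable]: "push_away n \<in> borel_measurable borel"
  unfolding push_away_def[abs_def] by measurable

lemma push_away_ge: "1 / Suc n \<le> \<bar>push_away n x\<bar>"
  by (auto simp: push_away_def)

lemma push_away_nonzero: "push_away n x \<noteq> 0"
  by (auto simp: push_away_def)

text \<open>Displaced mass sits at a point of size at most one, which gives a bound independent of
  \<open>n\<close>, as dominated convergence requires.\<close>

lemma exp_push_away_le: "exp (\<theta> * push_away n x) \<le> exp \<bar>\<theta>\<bar> + exp (\<theta> * x)"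
proof (cases "\<bar>x\<bar> < 1 / Suc n")
  case True
  have "\<theta> * (1 / Suc n) \<le> \<bar>\<theta>\<bar> * 1" by (intro mult_mono) auto
  then have "exp (\<theta> * (1 / Suc n)) \<le> exp \<bar>\<theta>\<bar>" by simp
  also have "\<dots> \<le> exp \<bar>\<theta>\<bar> + exp (\<theta> * x)" by simp
  finally show ?thesis using True by (simp add: push_away_def)
qed (simp add: push_away_def)

text \<open>At \<open>x = 0\<close> this is the second-order expansion of exp, which recovers the
  Gaussian value; at any other \<open>x\<close> the sequence is eventually constant.\<close>

lemma kolmogorov_kernel_push_away_tendsto:
  "(\<lambda>n. kolmogorov_kernel \<theta> (push_away n x)) \<longlonglongrightarrow> kolmogorov_kernel \<theta> x"
proof (cases "x = 0")
  case True
  have "(\<lambda>n. (exp (\<theta> * (1 / real (Suc n))) - 1 - \<theta> * (1 / real (Suc n))) / (1 / real (Suc n))\<^sup>2) \<longlonglongrightarrow> \<theta>\<^sup>2 / 2"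
    by (real_asymp simp: power2_eq_square)
  then show ?thesis using True by (simp add: kolmogorov_kernel_def push_away_def)
next
  case False
  have "\<forall>\<^sub>F n in sequentially. 1 / real (Suc n) < \<bar>x\<bar>"
    using order_tendstoD(2)[OF LIMSEQ_inverse_real_of_nat, of "\<bar>x\<bar>"] False
    by (simp add: inverse_eq_divide)
  then show ?thesis
    by (intro tendsto_eventually) (auto elim!: eventually_mono simp: push_away_def)
qed

text \<open>The factor \<open>c\<close> serves to take convolution roots: \<open>c = 1 / n\<close>
  divides the kernel part of the exponent by \<open>n\<close>.\<close>

lemma real_distribution_of_kolmogorov_exponent:
  assumes R: "finite_measure R" "sets R = sets borel" and S: "open S" "0 \<in> S"
    and lap: "has_laplace R S f" and c: "c \<ge> 0"
  obtains P where "real_distribution P"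
    "has_laplace P S (\<lambda>\<theta>. exp (\<theta> * b + c * (\<integral>x. kolmogorov_kernel \<theta> x \<partial>R)))"
proof -
  interpret finite_measure R by fact
  note [measurable_cong] = R(2)
  define E where "E = (\<lambda>n \<theta>. exp (\<theta> * b + c * (\<integral>x. kolmogorov_kernel \<theta> (push_away n x) \<partial>R)))"
  have dom: "integrable R (\<lambda>x. exp \<bar>\<theta>\<bar> + exp (\<theta> * x))" if "\<theta> \<in> S" for \<theta>
    using has_laplaceD(1)[OF lap that] by simp
  have "\<exists>P. real_distribution P \<and> has_laplace P S (E n)" for n
  proof -
    \<comment> \<open>With y = \<open>push_away n x\<close>, \<open>c\<close> times the kernel
      equals w exp(\<theta> y) - w - \<theta> c / y: a compound Poisson exponent plus a drift. Both
      w and 1 / y are bounded because y stays away from \<open>0\<close>.\<close>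
    define w where "w = (\<lambda>x. c / (push_away n x)\<^sup>2)"
    have w_meas [measurable]: "w \<in> borel_measurable borel" unfolding w_def by measurable
    have w0: "0 \<le> w x" for x using c by (simp add: w_def)
    have inv: "\<bar>1 / push_away n x\<bar> \<le> Suc n" for x
      using push_away_ge[of n x] push_away_nonzero[of n x] by (simp add: field_simps)
    have wB: "w x \<le> c * (Suc n)\<^sup>2" for x
      using mult_left_mono[OF power_mono[OF inv[of x], of 2] c]
      by (simp add: w_def power_divide)
    have intw: "integrable R w"
      by (rule integrable_const_bound[where B="c * (Suc n)\<^sup>2"]) (use w0 wB in auto)
    have intinv: "integrable R (\<lambda>x. 1 / push_away n x)"
      by (rule integrable_const_bound[where B="Suc n"]) (use inv in auto)
    have split: "(\<integral>x. A x - w x - k * B x \<partial>R) = (\<integral>x. A x \<partial>R) - (\<integral>x. w x \<partial>R) - k * (\<integral>x. B x \<partial>R)"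
      if "integrable R A" "integrable R B" for A B k
      using that intw by simp
    have intexp: "integrable R (\<lambda>x. w x * exp (\<theta> * push_away n x))" if "\<theta> \<in> S" for \<theta>
    proof (rule Bochner_Integration.integrable_bound)
      show "integrable R (\<lambda>x. c * (Suc n)\<^sup>2 * (exp \<bar>\<theta>\<bar> + exp (\<theta> * x)))" using dom[OF that] by simp
      have "w x * exp (\<theta> * push_away n x) \<le> c * (Suc n)\<^sup>2 * (exp \<bar>\<theta>\<bar> + exp (\<theta> * x))" for x
        by (rule mult_mono[OF wB exp_push_away_le]) (use c in auto)
      then show "AE x in R. norm (w x * exp (\<theta> * push_away n x)) \<le> norm (c * (Suc n)\<^sup>2 * (exp \<bar>\<theta>\<bar> + exp (\<theta> * x)))"
        using w0 c by (auto simp: abs_mult intro!: AE_I2 order.trans[OF _ abs_ge_self])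
    qed simp
    define L where "L = distr (density R (\<lambda>x. ennreal (w x))) borel (push_away n)"
    have L: "finite_measure L"
      unfolding L_def
    proof (intro finite_measure.finite_measure_distr finite_measureI)
      have "emeasure (density R (\<lambda>x. ennreal (w x))) (space (density R (\<lambda>x. ennreal (w x)))) = (\<integral>\<^sup>+x. ennreal (w x) \<partial>R)"
        by (simp add: emeasure_density cong: nn_integral_cong)
      also have "\<dots> = ennreal (\<integral>x. w x \<partial>R)" using intw w0 by (intro nn_integral_eq_integral) auto
      finally show "emeasure (density R (\<lambda>x. ennreal (w x))) (space (density R (\<lambda>x. ennreal (w x)))) \<noteq> \<infinity>" by simp
    qed simp
    have Llap: "has_laplace L S (\<lambda>\<theta>. \<integral>x. w x * exp (\<theta> * push_away n x) \<partial>R)"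
      unfolding has_laplace_def L_def
      using has_bochner_integral_integrable[OF intexp] w0
      by (auto intro!: has_bochner_integral_distr has_bochner_integral_density)
    have Ls: "sets L = sets borel" by (simp add: L_def)
    have Lm: "measure L UNIV = (\<integral>x. w x \<partial>R)"
      using has_laplaceD(2)[OF Llap S(2)] by (simp add: L_def)
    \<comment> \<open>The drift correction supplies the linear term - \<theta> c / y of the
      kernel.\<close>
    obtain P where P: "real_distribution P" and "has_laplace P S (\<lambda>\<theta>. exp (\<theta> * (b - c * (\<integral>x. 1 / push_away n x \<partial>R))
        + ((\<integral>x. w x * exp (\<theta> * push_away n x) \<partial>R) - measure L UNIV)))"
      by (rule compound_poisson_exists[OF L Ls Llap])
    moreover have "\<theta> * (b - c * (\<integral>x. 1 / push_away n x \<partial>R)) + ((\<integral>x. w x * exp (\<theta> * push_away n x) \<partial>R) - measure L UNIV)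
      = \<theta> * b + c * (\<integral>x. kolmogorov_kernel \<theta> (push_away n x) \<partial>R)" if "\<theta> \<in> S" for \<theta>
    proof -
      have "c * kolmogorov_kernel \<theta> (push_away n x)
        = w x * exp (\<theta> * push_away n x) - w x - \<theta> * c * (1 / push_away n x)" for x
        using push_away_nonzero[of n x]
        by (simp add: kolmogorov_kernel_def w_def power2_eq_square field_simps)
      then have "c * (\<integral>x. kolmogorov_kernel \<theta> (push_away n x) \<partial>R)
        = (\<integral>x. w x * exp (\<theta> * push_away n x) - w x - \<theta> * c * (1 / push_away n x) \<partial>R)"
        by (simp flip: integral_mult_right_zero)
      also have "\<dots> = (\<integral>x. w x * exp (\<theta> * push_away n x) \<partial>R) - (\<integral>x. w x \<partial>R) - \<theta> * c * (\<integral>x. 1 / push_away n x \<partial>R)"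
        by (rule split[OF intexp[OF that] intinv])
      finally show ?thesis by (simp add: Lm algebra_simps)
    qed
    ultimately show ?thesis unfolding E_def has_laplace_def using P by (intro exI[of _ P]) auto
  qed
  then obtain P where P: "\<And>n. real_distribution (P n)" "\<And>n. has_laplace (P n) S (E n)" by metis
  have lim: "(\<lambda>n. E n \<theta>) \<longlonglongrightarrow> exp (\<theta> * b + c * (\<integral>x. kolmogorov_kernel \<theta> x \<partial>R))" if "\<theta> \<in> S" for \<theta>
  proof -
    have "(\<lambda>n. \<integral>x. kolmogorov_kernel \<theta> (push_away n x) \<partial>R) \<longlonglongrightarrow> (\<integral>x. kolmogorov_kernel \<theta> x \<partial>R)"
    proof (rule integral_dominated_convergence)
      show "integrable R (\<lambda>x. \<theta>\<^sup>2 * (1 + (exp \<bar>\<theta>\<bar> + exp (\<theta> * x))))"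
        using has_laplaceD(1)[OF lap that] by simp
      show "AE x in R. norm (kolmogorov_kernel \<theta> (push_away n x)) \<le> \<theta>\<^sup>2 * (1 + (exp \<bar>\<theta>\<bar> + exp (\<theta> * x)))" for n
      proof (rule AE_I2)
        fix x
        have "\<bar>kolmogorov_kernel \<theta> (push_away n x)\<bar> \<le> \<theta>\<^sup>2 * (1 + exp (\<theta> * push_away n x))"
          by (rule kolmogorov_kernel_bound)
        also have "\<dots> \<le> \<theta>\<^sup>2 * (1 + (exp \<bar>\<theta>\<bar> + exp (\<theta> * x)))"
          by (intro mult_left_mono add_left_mono exp_push_away_le) auto
        finally show "norm (kolmogorov_kernel \<theta> (push_away n x)) \<le> \<theta>\<^sup>2 * (1 + (exp \<bar>\<theta>\<bar> + exp (\<theta> * x)))" by simp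
      qed
    qed (auto intro!: AE_I2 kolmogorov_kernel_push_away_tendsto)
    then show ?thesis unfolding E_def by (intro tendsto_intros)
  qed
  show thesis by (rule has_laplace_limit[OF P(1) S P(2) lim]) (use that in blast)+
qed

section \<open>The cumulant function\<close>

text \<open>For convexity, the exponential at a convex combination of exponents is at most the
  larger of the two exponentials, hence at most their sum.\<close>

lemma
  assumes [measurable_cong]: "sets \<beta> = sets borel"
  shows open_nef_domain: "open (nef_domain \<beta>)"
    and convex_nef_domain: "convex (nef_domain \<beta>)"
    and has_laplace_laplace: "has_laplace \<beta> (nef_domain \<beta>) (laplace \<beta>)"
proof -
  let ?D = "{\<theta>. (\<integral>\<^sup>+x. ennreal (exp (\<theta> * x)) \<partial>\<beta>) < \<infinity>}"
  show "open (nef_domain \<beta>)" by (simp add: nef_domain_def)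
  have "convex ?D"
  proof (rule convexI)
    fix a b u v :: real
    assume a: "a \<in> ?D" and b: "b \<in> ?D" and uv: "0 \<le> u" "0 \<le> v" "u + v = 1"
    have "(\<integral>\<^sup>+x. ennreal (exp ((u *\<^sub>R a + v *\<^sub>R b) * x)) \<partial>\<beta>)
        \<le> (\<integral>\<^sup>+x. ennreal (exp (a * x)) + ennreal (exp (b * x)) \<partial>\<beta>)"
    proof (rule nn_integral_mono)
      fix x
      have "(u *\<^sub>R a + v *\<^sub>R b) * x = u * (a * x) + v * (b * x)" by (simp add: algebra_simps)
      also have "\<dots> \<le> max (a * x) (b * x)" using uv by (intro convex_bound_le) auto
      finally have "exp ((u *\<^sub>R a + v *\<^sub>R b) * x) \<le> exp (a * x) + exp (b * x)"
        by (cases "a * x \<le> b * x") (auto simp: max_def elim!: order.trans[OF iffD2[OF exp_le_cancel_iff]])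
      then show "ennreal (exp ((u *\<^sub>R a + v *\<^sub>R b) * x)) \<le> ennreal (exp (a * x)) + ennreal (exp (b * x))"
        by (simp add: ennreal_plus[symmetric] del: ennreal_plus)
    qed
    also have "\<dots> = (\<integral>\<^sup>+x. ennreal (exp (a * x)) \<partial>\<beta>) + (\<integral>\<^sup>+x. ennreal (exp (b * x)) \<partial>\<beta>)"
      by (rule nn_integral_add) auto
    also have "\<dots> < \<infinity>" using a b by simp
    finally show "u *\<^sub>R a + v *\<^sub>R b \<in> ?D" by simp
  qed
  then show "convex (nef_domain \<beta>)" unfolding nef_domain_def by (rule convex_interior)
  have "integrable \<beta> (\<lambda>x. exp (\<theta> * x))" if "\<theta> \<in> nef_domain \<beta>" for \<theta>
    using that interior_subset[of ?D] by (intro integrableI_nonneg) (auto simp: nef_domain_def)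
  then show "has_laplace \<beta> (nef_domain \<beta>) (laplace \<beta>)"
    by (intro has_laplaceI) (auto simp: laplace_def)
qed

lemma has_laplace_pos:
  assumes M: "real_distribution M" and lap: "has_laplace M S f" and \<theta>: "\<theta> \<in> S"
  shows "f \<theta> > 0"
proof -
  interpret real_distribution M by fact
  have "(\<integral>x. exp (\<theta> * x) \<partial>M) \<noteq> 0"
  proof
    assume "(\<integral>x. exp (\<theta> * x) \<partial>M) = 0"
    then have "AE x in M. exp (\<theta> * x) = 0"
      using has_laplaceD(1)[OF lap \<theta>] by (subst (asm) integral_nonneg_eq_0_iff_AE) auto
    then show False by simp
  qed
  moreover have "(\<integral>x. exp (\<theta> * x) \<partial>M) \<ge> 0" by simp
  ultimately show ?thesis using has_laplaceD(2)[OF lap \<theta>] by simp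
qed

text \<open>The constant \<open>a\<close> is the cumulant when a probability measure is tilted, and
  \<open>0\<close> when the measure representing \<kappa>'' is.\<close>

lemma has_laplace_tilt:
  assumes [measurable_cong]: "sets M = sets borel" and "has_laplace M S f"
  shows "has_laplace (density M (\<lambda>x. ennreal (exp (t * x - a)))) {s. t + s \<in> S} (\<lambda>s. exp (- a) * f (t + s))"
  unfolding has_laplace_def
proof
  fix s assume "s \<in> {s. t + s \<in> S}"
  then have "has_bochner_integral M (\<lambda>x. exp ((t + s) * x)) (f (t + s))"
    using assms(2) by (simp add: has_laplace_def)
  then have "has_bochner_integral M (\<lambda>x. exp (- a) * exp ((t + s) * x)) (exp (- a) * f (t + s))"
    by (rule has_bochner_integral_mult_right)
  moreover have "exp (- a) * exp ((t + s) * x) = exp (t * x - a) *\<^sub>R exp (s * x)" for x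
    by (simp add: exp_add[symmetric] algebra_simps)
  ultimately show "has_bochner_integral (density M (\<lambda>x. ennreal (exp (t * x - a)))) (\<lambda>x. exp (s * x)) (exp (- a) * f (t + s))"
    by (intro has_bochner_integral_density) auto
qed

lemma finite_measure_of_has_laplace:
  assumes [measurable_cong]: "sets M = sets borel" and "has_laplace M S f" "0 \<in> S"
  shows "finite_measure M"
proof (rule finite_measureI)
  have "emeasure M (space M) = (\<integral>\<^sup>+x. ennreal (exp (0 * x)) \<partial>M)" by simp
  also have "\<dots> = ennreal (f 0)" using assms by (simp only: has_laplace_nn_integral)
  finally show "emeasure M (space M) \<noteq> \<infinity>" by simp
qed

context
  fixes \<beta> :: "real measure"
  assumes \<beta>: "real_distribution \<beta>"
begin

interpretation real_distribution \<beta> by (rule \<beta>)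

lemma laplace_pos: "\<theta> \<in> nef_domain \<beta> \<Longrightarrow> laplace \<beta> \<theta> > 0"
  by (rule has_laplace_pos[OF \<beta> has_laplace_laplace[OF events_eq_borel]])

lemma exp_cumulant: "\<theta> \<in> nef_domain \<beta> \<Longrightarrow> exp (cumulant \<beta> \<theta>) = laplace \<beta> \<theta>"
  using laplace_pos by (simp add: cumulant_def)

lemma cumulant_zero: "cumulant \<beta> 0 = 0"
  using prob_space by (simp add: cumulant_def laplace_def)

lemma cumulant_derivative_moments:
  assumes "\<theta> \<in> nef_domain \<beta>"
  defines "m \<equiv> \<lambda>k \<theta>. \<integral>x. x ^ k * exp (\<theta> * x) \<partial>\<beta>"
  shows "(cumulant \<beta> has_field_derivative m 1 \<theta> / m 0 \<theta>) (at \<theta>)"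
    "(deriv (cumulant \<beta>) has_field_derivative m 2 \<theta> / m 0 \<theta> - (m 1 \<theta> / m 0 \<theta>)\<^sup>2) (at \<theta>)"
proof -
  have mD: "(m k has_field_derivative m (Suc k) t) (at t)" if "t \<in> nef_domain \<beta>" for k t
    unfolding m_def by (rule moment_has_derivative[OF events_eq_borel open_nef_domain[OF events_eq_borel] has_laplace_laplace[OF events_eq_borel] that])
  have m0: "m 0 = laplace \<beta>" by (simp add: m_def laplace_def fun_eq_iff)
  have c: "cumulant \<beta> = (\<lambda>t. ln (m 0 t))" by (simp add: m0 cumulant_def fun_eq_iff)
  have D1: "(cumulant \<beta> has_field_derivative m 1 t / m 0 t) (at t)" if "t \<in> nef_domain \<beta>" for t
    unfolding c
    by (rule DERIV_cong[OF DERIV_ln_divide[THEN DERIV_chain2[OF _ mD[OF that]]]])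
      (use laplace_pos[OF that] in \<open>auto simp: m0\<close>)
  show "(cumulant \<beta> has_field_derivative m 1 \<theta> / m 0 \<theta>) (at \<theta>)" by (rule D1[OF assms(1)])
  have "((\<lambda>t. m 1 t / m 0 t) has_field_derivative m 2 \<theta> / m 0 \<theta> - (m 1 \<theta> / m 0 \<theta>)\<^sup>2) (at \<theta>)"
    by (rule DERIV_cong[OF DERIV_divide[OF mD mD]])
      (use laplace_pos[OF assms(1)] assms(1) in \<open>auto simp: m0 field_simps power2_eq_square numeral_2_eq_2\<close>)
  then show "(deriv (cumulant \<beta>) has_field_derivative m 2 \<theta> / m 0 \<theta> - (m 1 \<theta> / m 0 \<theta>)\<^sup>2) (at \<theta>)"
    by (rule has_field_derivative_transform_within_open[OF _ open_nef_domain[OF events_eq_borel] assms(1)])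
      (simp add: DERIV_imp_deriv[OF D1])
qed

lemma cumulant_derivative:
  assumes "\<theta> \<in> nef_domain \<beta>"
  shows "(cumulant \<beta> has_field_derivative deriv (cumulant \<beta>) \<theta>) (at \<theta>)"
    "(deriv (cumulant \<beta>) has_field_derivative deriv (deriv (cumulant \<beta>)) \<theta>) (at \<theta>)"
  using DERIV_deriv_iff_real_differentiable real_differentiable_def
    cumulant_derivative_moments[OF assms] by blast+

text \<open>The value is the variance of \<beta>; if it vanished, \<beta> would be concentrated at
  its mean.\<close>

lemma cumulant_second_derivative_pos:
  assumes "0 \<in> nef_domain \<beta>" and nondeg: "\<not> (\<exists>c. emeasure \<beta> (UNIV - {c}) = 0)"
  shows "deriv (deriv (cumulant \<beta>)) 0 > 0"
proof -
  have int: "integrable \<beta> (\<lambda>x. x ^ k)" for k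
    using integrable_moment[OF events_eq_borel open_nef_domain[OF events_eq_borel] has_laplace_laplace[OF events_eq_borel] assms(1), of k] by simp
  define \<mu> where "\<mu> = (\<integral>x. x \<partial>\<beta>)"
  have eq: "(x - \<mu>)\<^sup>2 = x ^ 2 - 2 * \<mu> * x ^ 1 + \<mu>\<^sup>2" for x by (simp add: power2_eq_square algebra_simps)
  have ints: "integrable \<beta> (\<lambda>x. (x - \<mu>)\<^sup>2)"
    unfolding eq by (intro Bochner_Integration.integrable_add Bochner_Integration.integrable_diff integrable_mult_right int) auto
  have "(\<integral>x. (x - \<mu>)\<^sup>2 \<partial>\<beta>) = (\<integral>x. x ^ 2 \<partial>\<beta>) - \<mu>\<^sup>2"
    unfolding eq using int[of 1] int[of 2] prob_space by (simp add: \<mu>_def[symmetric] power2_eq_square)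
  moreover have "deriv (deriv (cumulant \<beta>)) 0 = (\<integral>x. x ^ 2 \<partial>\<beta>) - \<mu>\<^sup>2"
    using DERIV_imp_deriv[OF cumulant_derivative_moments(2)[OF assms(1)]] prob_space by (simp add: \<mu>_def)
  moreover have "(\<integral>x. (x - \<mu>)\<^sup>2 \<partial>\<beta>) \<noteq> 0"
  proof
    assume "(\<integral>x. (x - \<mu>)\<^sup>2 \<partial>\<beta>) = 0"
    then have "AE x in \<beta>. (x - \<mu>)\<^sup>2 = 0"
      using ints by (subst (asm) integral_nonneg_eq_0_iff_AE) auto
    then have "AE x in \<beta>. x \<notin> UNIV - {\<mu>}" by simp
    then have "emeasure \<beta> (UNIV - {\<mu>}) = 0" by (subst (asm) AE_iff_measurable[OF _ refl]) (auto simp: set_diff_eq)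
    then show False using nondeg by blast
  qed
  moreover have "(\<integral>x. (x - \<mu>)\<^sup>2 \<partial>\<beta>) \<ge> 0" by simp
  ultimately show ?thesis by linarith
qed

end

section \<open>Infinite divisibility\<close>

text \<open>The transform of \<open>N\<close>, computed in [0, \<infinity>], has the finite
  \<open>n\<close>-th power \<open>exp (k \<theta>)\<close>. As \<open>n \<ge> 1\<close>, it is
  finite itself and is the unique non-negative root.\<close>

lemma has_laplace_root:
  assumes N: "real_distribution N" and \<beta>: "conv_power n N = \<beta>" and n: "n \<ge> 1"
    and lap: "has_laplace \<beta> S (\<lambda>\<theta>. exp (k \<theta>))"
  shows "has_laplace N S (\<lambda>\<theta>. exp (k \<theta> / n))"
  unfolding has_laplace_nn_integral[OF real_distribution.events_eq_borel[OF N]]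
proof (intro ballI conjI)
  fix \<theta> assume \<theta>: "\<theta> \<in> S"
  define a where "a = (\<integral>\<^sup>+x. ennreal (exp (\<theta> * x)) \<partial>N)"
  have "sets \<beta> = sets borel"
    unfolding \<beta>[symmetric] by (intro real_distribution.events_eq_borel real_distribution_conv_power N)
  then have "a ^ n = ennreal (exp (k \<theta>))"
    using lap \<theta> nn_integral_exp_conv_power[OF N, where \<theta> = \<theta> and n = n] by (simp add: has_laplace_nn_integral a_def \<beta>)
  moreover obtain r where r: "a = ennreal r" "r \<ge> 0"
  proof (cases a)
    case top
    then show ?thesis using calculation n by (simp add: power_eq_top_ennreal)
  qed (use that in auto)
  ultimately have "r ^ n = exp (k \<theta>)" by (simp add: ennreal_power)
  also have "\<dots> = exp (k \<theta> / n) ^ n" using n by (simp add: exp_of_nat_mult[symmetric])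
  finally have "r = exp (k \<theta> / n)" using n r by (intro power_eq_imp_eq_base[of r n]) auto
  then show "(\<integral>\<^sup>+x. ennreal (exp (\<theta> * x)) \<partial>N) = ennreal (exp (k \<theta> / n))"
    using r by (simp add: a_def)
qed simp

lemma second_moment_of_laplace:
  assumes sets: "sets N = sets borel" and S: "open S" and lap: "has_laplace N S f"
    and f: "\<And>\<theta>. \<theta> \<in> S \<Longrightarrow> (f has_field_derivative f' \<theta>) (at \<theta>)"
    and f': "\<And>\<theta>. \<theta> \<in> S \<Longrightarrow> (f' has_field_derivative f'' \<theta>) (at \<theta>)" and \<theta>: "\<theta> \<in> S"
  shows "(\<integral>x. x ^ 2 * exp (\<theta> * x) \<partial>N) = f'' \<theta>"
proof -
  have mD: "((\<lambda>\<theta>. \<integral>x. x ^ k * exp (\<theta> * x) \<partial>N) has_field_derivative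
      (\<integral>x. x ^ Suc k * exp (t * x) \<partial>N)) (at t)" if "t \<in> S" for k t
    by (rule moment_has_derivative[OF sets S lap that])
  have "(\<integral>x. x ^ Suc 0 * exp (t * x) \<partial>N) = f' t" if t: "t \<in> S" for t
    by (rule DERIV_unique[OF mD[OF t] has_field_derivative_transform_within_open[OF f[OF t] S t]])
      (simp add: has_laplaceD(2)[OF lap])
  then have "(\<integral>x. x ^ Suc (Suc 0) * exp (\<theta> * x) \<partial>N) = f'' \<theta>"
    by (intro DERIV_unique[OF mD[OF \<theta>] has_field_derivative_transform_within_open[OF f'[OF \<theta>] S \<theta>]])
      simp
  then show ?thesis by (simp add: numeral_2_eq_2)
qed

text \<open>Division by the second moment \<open>q 0\<close> gives a probability measure; a constant
  factor such as \<open>n\<close> cancels in this normalisation.\<close>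

lemma has_laplace_size_bias:
  assumes N: "sets N = sets borel" and S: "open S" "0 \<in> S" and lap: "has_laplace N S f"
    and q: "\<And>\<theta>. \<theta> \<in> S \<Longrightarrow> (\<integral>x. x ^ 2 * exp (\<theta> * x) \<partial>N) = q \<theta>" and q0: "q 0 > 0"
  shows "real_distribution (density N (\<lambda>x. ennreal (x\<^sup>2 / q 0)))"
    "has_laplace (density N (\<lambda>x. ennreal (x\<^sup>2 / q 0))) S (\<lambda>\<theta>. q \<theta> / q 0)"
proof -
  note [measurable_cong] = N
  let ?D = "density N (\<lambda>x. ennreal (x\<^sup>2 / q 0))"
  show D: "has_laplace ?D S (\<lambda>\<theta>. q \<theta> / q 0)"
    unfolding has_laplace_def
  proof
    fix \<theta> assume \<theta>: "\<theta> \<in> S"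
    have "has_bochner_integral N (\<lambda>x. x ^ 2 * exp (\<theta> * x)) (q \<theta>)"
      using integrable_moment[OF N S(1) lap \<theta>] q[OF \<theta>] by (simp add: has_bochner_integral_iff)
    then have "has_bochner_integral N (\<lambda>x. x ^ 2 * exp (\<theta> * x) / q 0) (q \<theta> / q 0)"
      by (rule has_bochner_integral_divide_zero)
    then show "has_bochner_integral ?D (\<lambda>x. exp (\<theta> * x)) (q \<theta> / q 0)"
      using q0 by (intro has_bochner_integral_density) auto
  qed
  have "emeasure ?D (space ?D) = (\<integral>\<^sup>+x. ennreal (exp (0 * x)) \<partial>?D)" by simp
  also have "\<dots> = ennreal (q 0 / q 0)"
    using D S(2) N by (simp only: has_laplace_nn_integral sets_density)
  finally show "real_distribution ?D"
    using q0 N by (auto simp: real_distribution_def real_distribution_axioms_def intro!: prob_spaceI)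
qed

text \<open>The normalised measures \<open>n * x\<^sup>2 * \<mu>\<^sub>n(dx)\<close>, with \<open>\<mu>\<^sub>n\<close> the \<open>n\<close>-th convolution root, have
  Laplace transforms converging to that of the measure representing the second derivative.\<close>

lemma infinitely_divisible_imp_representing_measure:
  assumes \<beta>: "real_distribution \<beta>" and dom0: "0 \<in> nef_domain \<beta>"
    and nondeg: "\<not> (\<exists>c. emeasure \<beta> (UNIV - {c}) = 0)" and id: "infinitely_divisible \<beta>"
  obtains R where "finite_measure R" "sets R = sets borel"
    "has_laplace R (nef_domain \<beta>) (deriv (deriv (cumulant \<beta>)))"
proof -
  interpret real_distribution \<beta> by (rule \<beta>)
  define S where "S = nef_domain \<beta>"
  define k0 where "k0 = cumulant \<beta>"
  define k1 where "k1 = deriv k0"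
  define k2 where "k2 = deriv k1"
  note S = open_nef_domain[OF real_distribution.events_eq_borel[OF \<beta>], folded S_def] dom0[folded S_def]
  have kD: "(k0 has_field_derivative k1 \<theta>) (at \<theta>)" "(k1 has_field_derivative k2 \<theta>) (at \<theta>)"
    if "\<theta> \<in> S" for \<theta>
    using cumulant_derivative[OF \<beta>] that by (auto simp: S_def k0_def k1_def k2_def)
  have k2pos: "k2 0 > 0"
    using cumulant_second_derivative_pos[OF \<beta> dom0 nondeg] by (simp add: k0_def k1_def k2_def)
  have lap: "has_laplace \<beta> S (\<lambda>\<theta>. exp (k0 \<theta>))"
    using has_laplace_laplace[OF real_distribution.events_eq_borel[OF \<beta>]] exp_cumulant[OF \<beta>] by (simp add: has_laplace_def S_def k0_def)
  \<comment> \<open>The second derivative of exp(\<kappa> / m) with m = \<open>Suc n\<close>, the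
    order of the root; the shift avoids order zero.\<close>
  define q where "q = (\<lambda>n \<theta>. (k2 \<theta> + k1 \<theta> * k1 \<theta> / real (Suc n)) / real (Suc n) * exp (k0 \<theta> / real (Suc n)))"
  have q0: "q n 0 > 0" for n
    using k2pos by (auto simp: q_def intro!: divide_pos_pos mult_pos_pos add_pos_nonneg)
  have "\<exists>P. real_distribution P \<and> has_laplace P S (\<lambda>\<theta>. q n \<theta> / q n 0)" for n
  proof -
    obtain N where "prob_space N" "sets N = sets borel" and conv: "conv_power (Suc n) N = \<beta>"
      using id by (auto simp: infinitely_divisible_def dest!: spec[of _ "Suc n"])
    then have N: "real_distribution N"
      by (simp add: real_distribution_def real_distribution_axioms_def)
    have lapN: "has_laplace N S (\<lambda>\<theta>. exp (k0 \<theta> / real (Suc n)))"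
      by (rule has_laplace_root[OF N conv _ lap]) simp
    have m2: "(\<integral>x. x ^ 2 * exp (\<theta> * x) \<partial>N) = q n \<theta>" if "\<theta> \<in> S" for \<theta>
    proof (rule second_moment_of_laplace[OF real_distribution.events_eq_borel[OF N] S(1) lapN _ _ that])
      fix t assume t: "t \<in> S"
      note kD = kD[OF t]
      show exp_D: "((\<lambda>\<theta>. exp (k0 \<theta> / real (Suc n))) has_field_derivative
          k1 t / real (Suc n) * exp (k0 t / real (Suc n))) (at t)"
        by (rule DERIV_cong[OF DERIV_fun_exp[OF DERIV_cdivide[OF kD(1)]]]) (rule mult.commute)
      show "((\<lambda>\<theta>. k1 \<theta> / real (Suc n) * exp (k0 \<theta> / real (Suc n))) has_field_derivative q n t) (at t)"
        by (rule DERIV_cong[OF DERIV_mult'[OF DERIV_cdivide[OF kD(2)] exp_D]])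
          (simp add: q_def field_simps del: of_nat_Suc)
    qed
    from has_laplace_size_bias[OF real_distribution.events_eq_borel[OF N] S lapN m2 q0] show ?thesis by blast
  qed
  then obtain P where P: "\<And>n. real_distribution (P n)" "\<And>n. has_laplace (P n) S (\<lambda>\<theta>. q n \<theta> / q n 0)"
    by metis
  have lim_q: "(\<lambda>n. q n \<theta> / q n 0) \<longlonglongrightarrow> k2 \<theta> / k2 0" for \<theta>
  proof -
    have inv: "(\<lambda>n. c / real (Suc n)) \<longlonglongrightarrow> 0" for c
      using tendsto_mult_right_zero[OF LIMSEQ_inverse_real_of_nat, of c] by (simp add: divide_inverse)
    have lim: "(\<lambda>n. (k2 t + k1 t * k1 t / real (Suc n)) * exp (k0 t / real (Suc n))) \<longlonglongrightarrow> (k2 t + 0) * exp 0" for t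
      by (intro tendsto_intros inv)
    have "(\<lambda>n. ((k2 \<theta> + k1 \<theta> * k1 \<theta> / real (Suc n)) * exp (k0 \<theta> / real (Suc n)))
      / ((k2 0 + k1 0 * k1 0 / real (Suc n)) * exp (k0 0 / real (Suc n)))) \<longlonglongrightarrow> (k2 \<theta> + 0) * exp 0 / ((k2 0 + 0) * exp 0)"
      by (intro tendsto_divide lim) (use k2pos in simp)
    moreover have "q n \<theta> / q n 0 = ((k2 \<theta> + k1 \<theta> * k1 \<theta> / real (Suc n)) * exp (k0 \<theta> / real (Suc n)))
      / ((k2 0 + k1 0 * k1 0 / real (Suc n)) * exp (k0 0 / real (Suc n)))" for n
      by (simp add: q_def del: of_nat_Suc)
    ultimately show ?thesis by simp
  qed
  obtain Q where Q: "real_distribution Q" "has_laplace Q S (\<lambda>\<theta>. k2 \<theta> / k2 0)"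
    by (rule has_laplace_limit[where P = P and f = "\<lambda>n \<theta>. q n \<theta> / q n 0", OF P(1) S P(2) lim_q])
  note [measurable_cong] = real_distribution.events_eq_borel[OF Q(1)]
  \<comment> \<open>Restores the total mass \<kappa>''(0) that the normalisation removed.\<close>
  define R where "R = scale_measure (ennreal (k2 0)) Q"
  have R: "sets R = sets borel" by (simp add: R_def real_distribution.events_eq_borel[OF Q(1)])
  have "ennreal (k2 0) * ennreal (k2 \<theta> / k2 0) = ennreal (k2 \<theta>)" if "0 \<le> k2 \<theta> / k2 0" for \<theta>
    using that k2pos by (simp add: ennreal_mult[symmetric])
  moreover have "0 \<le> k2 \<theta>" if "0 \<le> k2 \<theta> / k2 0" for \<theta>
    using that k2pos by (simp add: zero_le_divide_iff)
  ultimately have lapR: "has_laplace R S k2"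
    using Q(2) unfolding has_laplace_nn_integral[OF R] has_laplace_nn_integral[OF real_distribution.events_eq_borel[OF Q(1)]]
    by (auto simp: R_def nn_integral_scale_measure real_distribution.events_eq_borel[OF Q(1)])
  show thesis
    by (rule that[OF finite_measure_of_has_laplace[OF R lapR S(2)] R])
      (use lapR in \<open>simp add: S_def k0_def k1_def k2_def\<close>)
qed

section \<open>From the representing measure to a Levy triple\<close>

definition levy_of :: "real measure \<Rightarrow> real measure" where
  "levy_of R = density R (\<lambda>x. ennreal (if x = 0 then 0 else 1 / x\<^sup>2))"

lemma sets_levy_of [simp]: "sets (levy_of R) = sets R"
  by (simp add: levy_of_def)

text \<open>Off the origin the weights 1 / x^2 and x^2 cancel; at the origin the atom dropped by
  \<open>levy_of\<close> returns as the Gaussian coefficient.\<close>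

lemma levy_rho_levy_of:
  assumes R: "finite_measure R" "sets R = sets borel"
  shows "levy_rho (measure R {0}) (levy_of R) = R"
proof (rule measure_eqI)
  note [measurable_cong] = R(2)
  interpret finite_measure R by fact
  show "sets (levy_rho (measure R {0}) (levy_of R)) = sets R" by (simp add: R)
  fix A assume "A \<in> sets (levy_rho (measure R {0}) (levy_of R))"
  then have A [measurable]: "A \<in> sets R" "A \<in> sets borel" by (auto simp: R)
  have "(\<integral>\<^sup>+x\<in>A. ennreal (x\<^sup>2) \<partial>levy_of R)
      = (\<integral>\<^sup>+x. ennreal (if x = 0 then 0 else 1 / x\<^sup>2) * (ennreal (x\<^sup>2) * indicator A x) \<partial>R)"
    unfolding levy_of_def by (intro nn_integral_density) measurable
  also have "\<dots> = (\<integral>\<^sup>+x. indicator (A - {0}) x \<partial>R)"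
  proof (rule nn_integral_cong)
    fix x :: real
    have "ennreal (1 / x\<^sup>2) * ennreal (x\<^sup>2) = 1" if "x \<noteq> 0"
      using that by (simp add: ennreal_mult[symmetric])
    then show "ennreal (if x = 0 then 0 else 1 / x\<^sup>2) * (ennreal (x\<^sup>2) * indicator A x) = indicator (A - {0}) x"
      by (auto simp: indicator_def)
  qed
  also have "\<dots> = emeasure R (A - {0})" using A by (intro nn_integral_indicator) (auto simp: R)
  finally have "emeasure (levy_rho (measure R {0}) (levy_of R)) A
      = emeasure R {0} * indicator A 0 + emeasure R (A - {0})"
    using A by (subst emeasure_levy_rho) (auto simp: R emeasure_eq_measure)
  also have "\<dots> = emeasure R (A \<inter> {0}) + emeasure R (A - {0})"
    by (auto simp: indicator_def)
  also have "\<dots> = emeasure R ((A \<inter> {0}) \<union> (A - {0}))"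
    using A by (intro plus_emeasure) (auto simp: R)
  also have "(A \<inter> {0}) \<union> (A - {0}) = A" by auto
  finally show "emeasure (levy_rho (measure R {0}) (levy_of R)) A = emeasure R A" .
qed

lemma levy_measure_levy_of:
  assumes R: "finite_measure R" "sets R = sets borel"
  shows "levy_measure (levy_of R)"
  unfolding levy_measure_def
proof (intro conjI)
  note [measurable_cong] = R(2)
  interpret finite_measure R by fact
  show "sets (levy_of R) = sets borel" by (simp add: R)
  have "emeasure (levy_of R) {0} = (\<integral>\<^sup>+x. ennreal (if x = 0 then 0 else 1 / x\<^sup>2) * indicator {0} x \<partial>R)"
    unfolding levy_of_def by (intro emeasure_density) (auto simp: R)
  also have "\<dots> = (\<integral>\<^sup>+x. 0 \<partial>R)" by (intro nn_integral_cong) (auto simp: indicator_def)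
  finally show "emeasure (levy_of R) {0} = 0" by simp
  have "(\<integral>\<^sup>+x. ennreal (min 1 (x\<^sup>2)) \<partial>levy_of R)
      = (\<integral>\<^sup>+x. ennreal (if x = 0 then 0 else 1 / x\<^sup>2) * ennreal (min 1 (x\<^sup>2)) \<partial>R)"
    unfolding levy_of_def by (intro nn_integral_density) measurable
  also have "\<dots> \<le> (\<integral>\<^sup>+x. 1 \<partial>R)"
  proof (rule nn_integral_mono)
    fix x :: real
    have "ennreal (1 / x\<^sup>2) * ennreal (min 1 (x\<^sup>2)) = ennreal (min 1 (x\<^sup>2) / x\<^sup>2)"
      by (simp add: ennreal_mult[symmetric])
    also have "\<dots> \<le> ennreal 1" by (intro ennreal_leI divide_le_eq_1[THEN iffD2]) auto
    finally show "ennreal (if x = 0 then 0 else 1 / x\<^sup>2) * ennreal (min 1 (x\<^sup>2)) \<le> 1" by auto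
  qed
  also have "\<dots> < \<infinity>" using emeasure_finite[of "space R"] by (simp add: less_top[symmetric])
  finally show "(\<integral>\<^sup>+x. ennreal (min 1 (x\<^sup>2)) \<partial>levy_of R) < \<infinity>" .
qed

text \<open>The kernel splits into its value \<theta>^2 / 2 at the origin, charged by the atom of
  \<open>R\<close>, and the Levy integrand divided by x^2 elsewhere.\<close>

lemma has_bochner_integral_levy_of:
  assumes R: "finite_measure R" "sets R = sets borel" and int: "integrable R (\<lambda>x. exp (\<theta> * x))"
  shows "has_bochner_integral (levy_of R) (\<lambda>x. exp (\<theta> * x) - 1 - \<theta> * x)
    ((\<integral>x. kolmogorov_kernel \<theta> x \<partial>R) - measure R {0} * \<theta>\<^sup>2 / 2)"
proof -
  note [measurable_cong] = R(2)
  interpret finite_measure R by fact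
  have "has_bochner_integral R (\<lambda>x. indicator {0} x *\<^sub>R (\<theta>\<^sup>2 / 2)) (measure R {0} *\<^sub>R (\<theta>\<^sup>2 / 2))"
    by (intro has_bochner_integral_indicator) (auto simp: R less_top[symmetric])
  from has_bochner_integral_diff[OF has_bochner_integral_integrable[OF integrable_kolmogorov_kernel(1)[OF R int]] this]
  have "has_bochner_integral R (\<lambda>x. kolmogorov_kernel \<theta> x - indicator {0} x *\<^sub>R (\<theta>\<^sup>2 / 2))
    ((\<integral>x. kolmogorov_kernel \<theta> x \<partial>R) - measure R {0} * \<theta>\<^sup>2 / 2)" by simp
  moreover have "kolmogorov_kernel \<theta> x - indicator {0} x *\<^sub>R (\<theta>\<^sup>2 / 2)
      = (if x = 0 then 0 else 1 / x\<^sup>2) *\<^sub>R (exp (\<theta> * x) - 1 - \<theta> * x)" for x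
    by (auto simp: kolmogorov_kernel_def)
  ultimately show ?thesis
    unfolding levy_of_def by (intro has_bochner_integral_density) auto
qed

lemma levy_triple_of_representing_measure:
  assumes \<beta>: "real_distribution \<beta>" and dom0: "0 \<in> nef_domain \<beta>"
    and R: "finite_measure R" "sets R = sets borel"
    and lap: "has_laplace R (nef_domain \<beta>) (deriv (deriv (cumulant \<beta>)))"
  shows "levy_triple \<beta> (deriv (cumulant \<beta>) 0) (measure R {0}) (levy_of R)"
    "levy_variance_repr \<beta> (measure R {0}) (levy_of R)"
proof -
  show "levy_variance_repr \<beta> (measure R {0}) (levy_of R)"
    using lap by (simp add: levy_variance_repr_def levy_rho_levy_of[OF R] has_laplace_def)
  have "cumulant \<beta> \<theta> = \<theta> * deriv (cumulant \<beta>) 0 + (\<integral>x. kolmogorov_kernel \<theta> x \<partial>R)"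
    if "\<theta> \<in> nef_domain \<beta>" for \<theta>
    by (rule kolmogorov_representation[OF R open_nef_domain[OF real_distribution.events_eq_borel[OF \<beta>]] convex_nef_domain[OF real_distribution.events_eq_borel[OF \<beta>]] dom0 lap
          cumulant_derivative(1)[OF \<beta>] cumulant_derivative(2)[OF \<beta>] cumulant_zero[OF \<beta>] that])
  moreover have "centering_function (\<lambda>x. x)"
    by (simp add: centering_function_def Bfun_const)
  ultimately show "levy_triple \<beta> (deriv (cumulant \<beta>) 0) (measure R {0}) (levy_of R)"
    using has_bochner_integral_levy_of[OF R has_laplaceD(1)[OF lap]] levy_measure_levy_of[OF R]
    unfolding levy_triple_def
    by (intro conjI exI[of _ "\<lambda>x. x"]) (auto simp: has_bochner_integral_iff algebra_simps)
qed

section \<open>Roots of the members of the family\<close>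

lemma real_distribution_nef_member:
  assumes \<beta>: "real_distribution \<beta>" and t: "t \<in> nef_domain \<beta>"
  shows "real_distribution (nef_member \<beta> t)"
    "has_laplace (nef_member \<beta> t) {s. t + s \<in> nef_domain \<beta>} (\<lambda>s. exp (cumulant \<beta> (t + s) - cumulant \<beta> t))"
proof -
  interpret real_distribution \<beta> by (rule \<beta>)
  have sets: "sets (nef_member \<beta> t) = sets borel" by (simp add: nef_member_def)
  show lap: "has_laplace (nef_member \<beta> t) {s. t + s \<in> nef_domain \<beta>} (\<lambda>s. exp (cumulant \<beta> (t + s) - cumulant \<beta> t))"
    using has_laplace_tilt[OF events_eq_borel has_laplace_laplace[OF real_distribution.events_eq_borel[OF \<beta>]], of t "cumulant \<beta> t"] exp_cumulant[OF \<beta>]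
    by (simp add: has_laplace_def nef_member_def exp_diff exp_minus divide_inverse mult.commute)
  have "emeasure (nef_member \<beta> t) (space (nef_member \<beta> t)) = (\<integral>\<^sup>+x. ennreal (exp (0 * x)) \<partial>nef_member \<beta> t)" by simp
  also have "\<dots> = ennreal (exp (cumulant \<beta> (t + 0) - cumulant \<beta> t))"
    using bspec[OF lap[unfolded has_laplace_nn_integral[OF sets]], of 0] t by simp
  finally show "real_distribution (nef_member \<beta> t)"
    using sets by (auto simp: real_distribution_def real_distribution_axioms_def intro!: prob_spaceI)
qed

text \<open>The cumulant of the member at \<open>t\<close> is \<kappa>(t + s) - \<kappa>(t) in
  \<open>s\<close>, with second derivative represented by exp(t x) R(dx). A law with
  \<open>1 / n\<close> of its Kolmogorov exponent is the required root.\<close>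

lemma infinitely_divisible_nef_member:
  assumes \<beta>: "real_distribution \<beta>" and R: "sets R = sets borel"
    and lap: "has_laplace R (nef_domain \<beta>) (deriv (deriv (cumulant \<beta>)))"
    and t: "t \<in> nef_domain \<beta>"
  shows "infinitely_divisible (nef_member \<beta> t)"
  unfolding infinitely_divisible_def
proof (intro allI impI)
  fix n :: nat assume n: "n \<ge> 1"
  note F = real_distribution_nef_member[OF \<beta> t]
  define S where "S = {s. t + s \<in> nef_domain \<beta>}"
  have S_eq: "S = (+) (- t) ` nef_domain \<beta>"
    by (auto simp: S_def intro!: image_eqI[of _ _ "t + _"])
  have S: "open S" "convex S" "0 \<in> S"
    unfolding S_eq using open_nef_domain[OF real_distribution.events_eq_borel[OF \<beta>]] convex_nef_domain[OF real_distribution.events_eq_borel[OF \<beta>]] t by (auto intro: open_translation_subtract convex_translation_subtract)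
  \<comment> \<open>Subtracting \<open>0\<close> matches the tilting rule without normalisation:
    \<open>T\<close> must represent \<kappa>'' itself.\<close>
  define T where "T = density R (\<lambda>x. ennreal (exp (t * x - 0)))"
  have T: "sets T = sets borel" by (simp add: T_def R)
  have lapT: "has_laplace T S (\<lambda>s. deriv (deriv (cumulant \<beta>)) (t + s))"
    using has_laplace_tilt[OF R lap, of t 0] by (simp add: T_def S_def)
  note finT = finite_measure_of_has_laplace[OF T lapT S(3)]
  have shift: "((\<lambda>s. g (t + s)) has_field_derivative D) (at s)" if "(g has_field_derivative D) (at (t + s))" for g D s
    using that by (simp add: DERIV_shift add.commute)
  have K: "cumulant \<beta> (t + s) - cumulant \<beta> t = s * deriv (cumulant \<beta>) (t + 0) + (\<integral>x. kolmogorov_kernel s x \<partial>T)"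
    if "s \<in> S" for s
  proof (rule kolmogorov_representation[OF finT T S lapT _ _ _ that])
    fix s assume "s \<in> S"
    then have s: "t + s \<in> nef_domain \<beta>" by (simp add: S_def)
    show "((\<lambda>s. cumulant \<beta> (t + s) - cumulant \<beta> t) has_field_derivative deriv (cumulant \<beta>) (t + s)) (at s)"
      using DERIV_diff[OF shift[OF cumulant_derivative(1)[OF \<beta> s]] DERIV_const] by simp
    show "((\<lambda>s. deriv (cumulant \<beta>) (t + s)) has_field_derivative deriv (deriv (cumulant \<beta>)) (t + s)) (at s)"
      by (rule shift[OF cumulant_derivative(2)[OF \<beta> s]])
  qed simp
  obtain P where P: "real_distribution P" and lapP: "has_laplace P S
      (\<lambda>s. exp (s * (deriv (cumulant \<beta>) (t + 0) / n) + 1 / n * (\<integral>x. kolmogorov_kernel s x \<partial>T)))"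
    by (rule real_distribution_of_kolmogorov_exponent[OF finT T S(1,3) lapT, of "1 / n"]) simp
  have "exp (s * (deriv (cumulant \<beta>) (t + 0) / n) + 1 / n * (\<integral>x. kolmogorov_kernel s x \<partial>T)) ^ n
      = exp (cumulant \<beta> (t + s) - cumulant \<beta> t)" if "s \<in> S" for s
    unfolding K[OF that] using n by (simp add: exp_of_nat_mult[symmetric] field_simps)
  then have "has_laplace (conv_power n P) S (\<lambda>s. exp (cumulant \<beta> (t + s) - cumulant \<beta> t))"
    using has_laplace_conv_power[OF P lapP, of n] by (simp add: has_laplace_def)
  \<comment> \<open>Uniqueness turns the equality of transforms near \<open>0\<close> into equality
    of measures.\<close>
  then have "conv_power n P = nef_member \<beta> t"
    by (intro has_laplace_unique[OF real_distribution_conv_power[OF P] F(1) S])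
      (use F(2) in \<open>simp_all add: S_def\<close>)
  then show "\<exists>\<mu>n. prob_space \<mu>n \<and> sets \<mu>n = sets borel \<and> conv_power n \<mu>n = nef_member \<beta> t"
    using P by (auto simp: real_distribution_def real_distribution.events_eq_borel)
qed

lemma nef_member_zero:
  assumes "real_distribution \<beta>"
  shows "nef_member \<beta> 0 = \<beta>"
  by (simp add: nef_member_def cumulant_zero[OF assms] density_1)

section \<open>Reduction functions\<close>

lemma reduction_function_iff_laplace_agrees:
  assumes "has_laplace \<alpha> (nef_domain \<beta>) (\<lambda>\<theta>. laplace \<beta> \<theta> * deriv (deriv (cumulant \<beta>)) \<theta>)"
  shows "reduction_function \<beta> \<phi> \<longleftrightarrow> laplace_agrees \<beta> \<phi> \<alpha>"
  using has_laplaceD[OF assms]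
  by (auto simp: reduction_function_def laplace_agrees_def has_bochner_integral_iff mult.commute)

text \<open>The derivative takes extended values, but is finite almost everywhere because \<alpha>
  is \<sigma>-finite, so passing to real values leaves the density unchanged.\<close>

lemma laplace_agrees_RN_deriv:
  assumes \<beta>: "real_distribution \<beta>" and \<alpha>: "finite_measure \<alpha>" "sets \<alpha> = sets borel"
    and ac: "absolutely_continuous \<beta> \<alpha>"
    and lap: "has_laplace \<alpha> (nef_domain \<beta>) f"
  shows "laplace_agrees \<beta> (\<lambda>x. enn2real (RN_deriv \<beta> \<alpha> x)) \<alpha>"
proof -
  interpret real_distribution \<beta> by (rule \<beta>)
  interpret \<alpha>: finite_measure \<alpha> by fact
  let ?\<phi> = "\<lambda>x. enn2real (RN_deriv \<beta> \<alpha> x)"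
  have [measurable]: "RN_deriv \<beta> \<alpha> \<in> borel_measurable borel"
    using borel_measurable_RN_deriv[of \<beta> \<alpha>] by simp
  have sets: "sets \<alpha> = sets \<beta>" by (simp add: \<alpha>)
  have "AE x in \<beta>. ennreal (?\<phi> x) = RN_deriv \<beta> \<alpha> x"
    using RN_deriv_finite[OF \<alpha>.sigma_finite_measure_axioms ac sets] by eventually_elim (simp add: less_top)
  then have "density \<beta> (\<lambda>x. ennreal (?\<phi> x)) = density \<beta> (RN_deriv \<beta> \<alpha>)"
    by (intro density_cong) auto
  then have D: "\<alpha> = density \<beta> (\<lambda>x. ennreal (?\<phi> x))" using density_RN_deriv[OF ac sets] by simp
  have "integrable \<beta> (\<lambda>x. ?\<phi> x * exp (\<theta> * x))" "(\<integral>x. ?\<phi> x * exp (\<theta> * x) \<partial>\<beta>) = (\<integral>x. exp (\<theta> * x) \<partial>\<alpha>)"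
    if "integrable \<alpha> (\<lambda>x. exp (\<theta> * x))" for \<theta>
    using that by (subst (asm) D, subst (asm) integrable_density, auto)
      (subst (2) D, subst integral_density, auto)
  then show ?thesis using has_laplaceD(1)[OF lap] by (simp add: laplace_agrees_def)
qed

theorem proposition2:
  fixes \<beta> :: "real measure"
  assumes "nef_basis \<beta>" and "0 \<in> nef_domain \<beta>" and "emeasure \<beta> UNIV = 1"
  shows
    "(infinitely_divisible_family (nef \<beta>) \<longleftrightarrow>
        (\<exists>\<epsilon> \<sigma>2 \<nu>. levy_triple \<beta> \<epsilon> \<sigma>2 \<nu> \<and> levy_variance_repr \<beta> \<sigma>2 \<nu>)) \<and>
     (\<forall>\<epsilon> \<sigma>2 \<nu> \<alpha>.
        infinitely_divisible_family (nef \<beta>) \<and>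
        levy_triple \<beta> \<epsilon> \<sigma>2 \<nu> \<and> levy_variance_repr \<beta> \<sigma>2 \<nu> \<and>
        \<alpha> = (\<beta> \<star> levy_rho \<sigma>2 \<nu>) \<longrightarrow>
          (\<forall>\<phi>. reduction_function \<beta> \<phi> \<longleftrightarrow> laplace_agrees \<beta> \<phi> \<alpha>) \<and>
          (absolutely_continuous \<beta> \<alpha> \<longrightarrow>
             (let \<phi> = (\<lambda>x. enn2real (RN_deriv \<beta> \<alpha> x))
              in reduction_function \<beta> \<phi> \<and> laplace_agrees \<beta> \<phi> \<alpha>)))"
proof -
  have sets: "sets \<beta> = sets borel" and nondeg: "\<not> (\<exists>c. emeasure \<beta> (UNIV - {c}) = 0)"
    using assms(1) by (auto simp: nef_basis_def)
  have \<beta>: "real_distribution \<beta>"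
    using sets assms(3) sets_eq_imp_space_eq[OF sets]
    by (auto simp: real_distribution_def real_distribution_axioms_def intro!: prob_spaceI)
  have rho: "has_laplace (levy_rho \<sigma>2 \<nu>) (nef_domain \<beta>) (deriv (deriv (cumulant \<beta>)))"
    if "levy_variance_repr \<beta> \<sigma>2 \<nu>" for \<sigma>2 \<nu>
    using that by (simp add: levy_variance_repr_def has_laplace_def)
  have id_iff: "infinitely_divisible_family (nef \<beta>) \<longleftrightarrow>
      (\<exists>\<epsilon> \<sigma>2 \<nu>. levy_triple \<beta> \<epsilon> \<sigma>2 \<nu> \<and> levy_variance_repr \<beta> \<sigma>2 \<nu>)"
  proof
    assume "infinitely_divisible_family (nef \<beta>)"
    \<comment> \<open>\<beta> is the member at \<theta> = 0, and its divisibility alone produces the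
      triple.\<close>
    moreover have "\<beta> \<in> nef \<beta>"
      unfolding nef_def using nef_member_zero[OF \<beta>] assms(2) by (metis image_eqI)
    ultimately have "infinitely_divisible \<beta>" by (simp add: infinitely_divisible_family_def)
    from infinitely_divisible_imp_representing_measure[OF \<beta> assms(2) nondeg this]
    show "\<exists>\<epsilon> \<sigma>2 \<nu>. levy_triple \<beta> \<epsilon> \<sigma>2 \<nu> \<and> levy_variance_repr \<beta> \<sigma>2 \<nu>"
      using levy_triple_of_representing_measure[OF \<beta> assms(2)] by metis
  next
    assume "\<exists>\<epsilon> \<sigma>2 \<nu>. levy_triple \<beta> \<epsilon> \<sigma>2 \<nu> \<and> levy_variance_repr \<beta> \<sigma>2 \<nu>"
    then show "infinitely_divisible_family (nef \<beta>)"
      using infinitely_divisible_nef_member[OF \<beta> sets_levy_rho rho]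
      by (auto simp: infinitely_divisible_family_def nef_def)
  qed
  have red: "(\<forall>\<phi>. reduction_function \<beta> \<phi> \<longleftrightarrow> laplace_agrees \<beta> \<phi> \<alpha>) \<and>
      (absolutely_continuous \<beta> \<alpha> \<longrightarrow> laplace_agrees \<beta> (\<lambda>x. enn2real (RN_deriv \<beta> \<alpha> x)) \<alpha>)"
    if "levy_variance_repr \<beta> \<sigma>2 \<nu>" and \<alpha>: "\<alpha> = (\<beta> \<star> levy_rho \<sigma>2 \<nu>)" for \<sigma>2 \<nu> \<alpha>
  proof -
    note fin = real_distribution_finite_measure[OF \<beta>]
      finite_measure_of_has_laplace[OF sets_levy_rho rho[OF that(1)] assms(2)]
    \<comment> \<open>Convolution multiplies the transforms L and \<kappa>'', so the two conditions
      on \<phi> have the same right-hand side.\<close>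
    have lap: "has_laplace \<alpha> (nef_domain \<beta>) (\<lambda>\<theta>. laplace \<beta> \<theta> * deriv (deriv (cumulant \<beta>)) \<theta>)"
      unfolding \<alpha> by (rule has_laplace_convolution[OF fin(1) sets has_laplace_laplace[OF real_distribution.events_eq_borel[OF \<beta>]] fin(2) sets_levy_rho rho[OF that(1)]])
    have "finite_measure \<alpha>" "sets \<alpha> = sets borel"
      unfolding \<alpha> by (simp_all add: convolution_finite[OF fin sets_levy_rho sets])
    from laplace_agrees_RN_deriv[OF \<beta> this _ lap] reduction_function_iff_laplace_agrees[OF lap]
    show ?thesis by blast
  qed
  show ?thesis
    unfolding Let_def using id_iff red by blast
qed

end
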